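(* Let $(m,n,r)$ be a triple of natural numbers with $m,n\ge 1$, $\gcd(m,n)=\gcd(m,r-1)=1$ and $r^n\equiv 1 \pmod m$, and let $ZM(m,n,r)=\langle a,b \mid a^m=b^n=1,\ b^{-1}ab=a^r\rangle$. For divisors $m_1\mid m$ and $n_1\mid n$ let $H(m_1,n_1,0)=\langle a^{m_1},b^{n_1}\rangle$ and $f_{m_1,n_1}=F_2(H(m_1,n_1,0))$. Then the subgroup commutativity degree of $ZM(m,n,r)$ is $$sd(ZM(m,n,r))=\frac{\sum\limits_{m_1\mid m}\sum\limits_{n_1\mid n}\gcd\left(m_1,\frac{r^n-1}{r^{n_1}-1}\right)f_{m_1,n_1}}{\left[\sum\limits_{m_1\mid m}\sum\limits_{n_1\mid n}\gcd\left(m_1,\frac{r^n-1}{r^{n_1}-1}\right)\right]^2}.$$ In particular, $sd(ZM(9,4,8))=\frac{13}{19}$.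
   Context: For a finite group $G$, $L(G)$ denotes the set (lattice) of all subgroups of $G$. The subgroup commutativity degree of $G$ is $sd(G)=\frac{1}{|L(G)|^2}|\{(H,K)\in L(G)^2\mid HK=KH\}|$, and the factorization number of $G$ is $F_2(G)=|\{(H,K)\in L(G)^2\mid HK=G\}|$ (ordered pairs), where $HK=\{hk\mid h\in H,k\in K\}$. A ZM-group $ZM(m,n,r)$ is the finite group of order $mn$ given by the presentation in the claim under the stated conditions on $(m,n,r)$. When $r=1$ (which forces $m=1$), the quotient $\frac{r^n-1}{r^{k}-1}$, for $k\mid n$, is read as $\sum_{i=0}^{n/k-1} r^{ik}$. *)

theory Defs
  imports Complex_Main "HOL-Algebra.Generated_Groups" "HOL-Number_Theory.Cong"
begin

definition subgroup_lattice :: "('a, 'b) monoid_scheme \<Rightarrow> 'a set set"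
  where "subgroup_lattice G = {H. subgroup H G}"

definition sd :: "('a, 'b) monoid_scheme \<Rightarrow> real"
  where "sd G =
    real (card {(H, K) \<in> subgroup_lattice G \<times> subgroup_lattice G. H <#>\<^bsub>G\<^esub> K = K <#>\<^bsub>G\<^esub> H})
      / (real (card (subgroup_lattice G)))\<^sup>2"

definition F2 :: "('a, 'b) monoid_scheme \<Rightarrow> nat"
  where "F2 G =
    card {(H, K) \<in> subgroup_lattice G \<times> subgroup_lattice G. H <#>\<^bsub>G\<^esub> K = carrier G}"

text \<open>
  Groups given by generators and relations. A letter \<open>(x, True)\<close> stands for the generator \<open>x\<close>
  and \<open>(x, False)\<close> for its formal inverse; a pair \<open>(s, t)\<close> in the set of relations stands for
  the defining relation \<open>s = t\<close>.
\<close>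

type_synonym 'g word = "('g \<times> bool) list"

inductive word_eq :: "('g word \<times> 'g word) set \<Rightarrow> 'g word \<Rightarrow> 'g word \<Rightarrow> bool"
  for R where
  refl: "word_eq R u u"
| sym: "word_eq R u v \<Longrightarrow> word_eq R v u"
| trans: "word_eq R u v \<Longrightarrow> word_eq R v w \<Longrightarrow> word_eq R u w"
| cancel: "word_eq R (u @ [(x, e), (x, \<not> e)] @ v) (u @ v)"
| relation: "(s, t) \<in> R \<Longrightarrow> word_eq R (u @ s @ v) (u @ t @ v)"

definition word_class :: "('g word \<times> 'g word) set \<Rightarrow> 'g word \<Rightarrow> 'g word set"
  where "word_class R u = {v. word_eq R u v}"

definition presented_group :: "('g word \<times> 'g word) set \<Rightarrow> 'g word set monoid"
  where "presented_group R =
    \<lparr>carrier = range (word_class R),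
     monoid.mult = (\<lambda>X Y. \<Union>u\<in>X. \<Union>v\<in>Y. word_class R (u @ v)),
     one = word_class R []\<rparr>"

datatype zm_gen = A | B

definition zm_relations :: "nat \<Rightarrow> nat \<Rightarrow> nat \<Rightarrow> (zm_gen word \<times> zm_gen word) set"
  where "zm_relations m n r =
    {(replicate m (A, True), []),
     (replicate n (B, True), []),
     ([(B, False), (A, True), (B, True)], replicate r (A, True))}"

definition ZM :: "nat \<Rightarrow> nat \<Rightarrow> nat \<Rightarrow> zm_gen word set monoid"
  where "ZM m n r = presented_group (zm_relations m n r)"

definition zm_a :: "nat \<Rightarrow> nat \<Rightarrow> nat \<Rightarrow> zm_gen word set"
  where "zm_a m n r = word_class (zm_relations m n r) [(A, True)]"

definition zm_b :: "nat \<Rightarrow> nat \<Rightarrow> nat \<Rightarrow> zm_gen word set"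
  where "zm_b m n r = word_class (zm_relations m n r) [(B, True)]"

text \<open>The subgroup \<open>H(m\<^sub>1, n\<^sub>1, 0)\<close>.\<close>

definition zm_H :: "nat \<Rightarrow> nat \<Rightarrow> nat \<Rightarrow> nat \<Rightarrow> nat \<Rightarrow> zm_gen word set set"
  where "zm_H m n r m1 n1 =
    generate (ZM m n r)
      {zm_a m n r [^]\<^bsub>ZM m n r\<^esub> m1, zm_b m n r [^]\<^bsub>ZM m n r\<^esub> n1}"

definition zm_f :: "nat \<Rightarrow> nat \<Rightarrow> nat \<Rightarrow> nat \<Rightarrow> nat \<Rightarrow> nat"
  where "zm_f m n r m1 n1 = F2 ((ZM m n r)\<lparr>carrier := zm_H m n r m1 n1\<rparr>)"

text \<open>
  The quotient \<open>(r\<^sup>n - 1) / (r\<^sup>k - 1)\<close> for \<open>k dvd n\<close>, \<open>k > 0\<close>; the division is exact. For \<open>r = 1\<close>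
  it is read as a geometric sum. Working in \<open>int\<close> keeps the subtraction correct for \<open>r = 0\<close>.
\<close>

definition pow_quot :: "nat \<Rightarrow> nat \<Rightarrow> nat \<Rightarrow> int"
  where "pow_quot r n k =
    (if r = 1 then (\<Sum>i<n div k. int r ^ (i * k))
     else (int r ^ n - 1) div (int r ^ k - 1))"

end

theory Submission
  imports Defs "HOL-Algebra.Multiplicative_Group"
begin

text \<open>
  If \<open>HK = KH\<close> then \<open>HK\<close> is a subgroup, so grouping the commuting pairs by their product shows that
  their number is the sum of \<open>F2 M\<close> over all subgroups \<open>M\<close>. Every subgroup of \<open>ZM(m,n,r)\<close> is
  \<open>H(m1,n1,s) = \<langle>a^m1, b^n1 a^s\<rangle>\<close> for unique \<open>m1 dvd m\<close>, \<open>n1 dvd n\<close>, \<open>s < m1\<close> with \<open>m1 dvd s Q\<close>, where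
  \<open>Q = (r^n - 1) / (r^n1 - 1)\<close>; for given \<open>m1, n1\<close> there are \<open>gcd m1 Q\<close> such \<open>s\<close>. Since \<open>Q\<close> is congruent to
  \<open>n / n1\<close> modulo \<open>r^n1 - 1\<close> and \<open>n\<close> is coprime to \<open>m\<close>, the congruence \<open>x (r^n1 - 1) = - s\<close> modulo \<open>m1\<close> is
  solvable, and \<open>a^x\<close> conjugates \<open>H(m1,n1,0)\<close> to \<open>H(m1,n1,s)\<close>; hence \<open>F2\<close> depends on \<open>m1, n1\<close> only.

  In \<open>ZM(9,4,8)\<close> the element \<open>b^2\<close> is central and \<open>b\<close> inverts \<open>a\<close>. Subgroups with \<open>n1 \<noteq> 1\<close> are normal,
  and two subgroups with \<open>n1 = 1\<close> commute iff their parameters \<open>s, t\<close> agree modulo the gcd of their \<open>m1\<close>;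
  of the \<open>19^2\<close> pairs, \<open>247 = 13 * 19\<close> commute.
\<close>

section \<open>Commuting pairs of subgroups and factorizations\<close>

text \<open>Both factors lie in their product, since each contains the identity. Pairs of subgroups
  of \<open>G\<close> with product \<open>M\<close> are therefore automatically pairs of subgroups
  of \<open>M\<close>.\<close>

lemma (in group) F2_subgroup:
  assumes M: "subgroup M G"
  shows "F2 (G\<lparr>carrier := M\<rparr>)
    = card {(H, K) \<in> subgroup_lattice G \<times> subgroup_lattice G. H <#> K = M}"
proof -
  have sub: "subgroup H (G\<lparr>carrier := M\<rparr>) \<longleftrightarrow> subgroup H G \<and> H \<subseteq> M" for H
    using incl_subgroup[OF M] subgroup_incl[OF _ M] subgroup.subset[of H "G\<lparr>carrier := M\<rparr>"]
    by auto
  have "H \<subseteq> M \<and> K \<subseteq> M" if "subgroup H G" "subgroup K G" "H <#> K = M" for H K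
  proof -
    have "h \<in> H <#> K" if "h \<in> H" for h
      using that subgroup.one_closed[OF \<open>subgroup K G\<close>] subgroup.mem_carrier[OF \<open>subgroup H G\<close>]
      unfolding set_mult_def by force
    moreover have "k \<in> H <#> K" if "k \<in> K" for k
      using that subgroup.one_closed[OF \<open>subgroup H G\<close>] subgroup.mem_carrier[OF \<open>subgroup K G\<close>]
      unfolding set_mult_def by force
    ultimately show ?thesis using that by auto
  qed
  then show ?thesis
    unfolding F2_def subgroup_lattice_def by (intro arg_cong[where f = card]) (auto simp: sub)
qed

text \<open>Inversion swaps \<open>H <#> K\<close> and \<open>K <#> H\<close>. This gives closure
  under inverses when the two agree, and their agreement when \<open>H <#> K\<close> is closed under
  inverses.\<close>

lemma (in group) set_mult_commute_iff_subgroup: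
  assumes H: "subgroup H G" and K: "subgroup K G"
  shows "H <#> K = K <#> H \<longleftrightarrow> subgroup (H <#> K) G"
proof -
  have inv_swap: "inv x \<in> K' <#> H'" if x: "x \<in> H' <#> K'" and "subgroup H' G" "subgroup K' G" for x H' K'
  proof -
    obtain h k where hk: "h \<in> H'" "k \<in> K'" "x = h \<otimes> k"
      using x unfolding set_mult_def by blast
    then have "inv x = inv k \<otimes> inv h"
      using that by (simp add: inv_mult_group subgroup.mem_carrier)
    then show ?thesis
      using hk that unfolding set_mult_def by (auto intro: subgroup.m_inv_closed)
  qed
  have closed: "H <#> K \<subseteq> carrier G" "K <#> H \<subseteq> carrier G"
    using H K by (simp_all add: set_mult_closed subgroup.subset)
  show ?thesis
  proof
    assume comm: "H <#> K = K <#> H"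
    show "subgroup (H <#> K) G"
    proof
      show "H <#> K \<subseteq> carrier G" by fact
      show "\<one> \<in> H <#> K"
        unfolding set_mult_def using subgroup.one_closed[OF H] subgroup.one_closed[OF K] by force
      show "inv x \<in> H <#> K" if "x \<in> H <#> K" for x
        using inv_swap[OF that H K] comm by simp
      fix x y assume "x \<in> H <#> K" "y \<in> H <#> K"
      then have "x \<otimes> y \<in> (H <#> K) <#> (H <#> K)"
        unfolding set_mult_def by blast
      also have "\<dots> = H <#> (K <#> H) <#> K"
        using H K closed by (simp add: set_mult_assoc subgroup.subset)
      also have "\<dots> = (H <#> H) <#> (K <#> K)"
        using H K closed by (simp add: comm[symmetric] set_mult_assoc set_mult_closed subgroup.subset)
      also have "\<dots> = H <#> K"
        using H K by (simp add: subgroup_mult_id)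
      finally show "x \<otimes> y \<in> H <#> K" .
    qed
  next
    assume HK: "subgroup (H <#> K) G"
    have "x \<in> K <#> H" if "x \<in> H <#> K" for x
      using inv_swap[OF subgroup.m_inv_closed[OF HK that] H K] that closed by (simp add: subsetD)
    moreover have "x \<in> H <#> K" if "x \<in> K <#> H" for x
      using subgroup.m_inv_closed[OF HK inv_swap[OF that K H]] that closed by (simp add: subsetD)
    ultimately show "H <#> K = K <#> H" by blast
  qed
qed

lemma (in group) finite_subgroup_lattice:
  "finite (carrier G) \<Longrightarrow> finite (subgroup_lattice G)"
  by (rule finite_subset[of _ "Pow (carrier G)"]) (auto simp: subgroup_lattice_def dest: subgroup.mem_carrier)

lemma (in group) card_commuting_pairs:
  assumes "finite (carrier G)"
  shows "card {(H, K) \<in> subgroup_lattice G \<times> subgroup_lattice G. H <#> K = K <#> H}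
    = (\<Sum>M\<in>subgroup_lattice G. F2 (G\<lparr>carrier := M\<rparr>))"
proof -
  let ?L = "subgroup_lattice G"
  let ?S = "\<lambda>M. {(H, K) \<in> ?L \<times> ?L. H <#> K = M}"
  have fin: "finite ?L" by (rule finite_subgroup_lattice) fact
  have "{(H, K) \<in> ?L \<times> ?L. H <#> K = K <#> H} = (\<Union>M\<in>?L. ?S M)"
    using set_mult_commute_iff_subgroup unfolding subgroup_lattice_def by blast
  moreover have "card (\<Union>M\<in>?L. ?S M) = (\<Sum>M\<in>?L. card (?S M))"
  proof (rule card_UN_disjoint[OF fin])
    show "\<forall>M\<in>?L. finite (?S M)"
      by (intro ballI finite_subset[OF _ finite_cartesian_product[OF fin fin]]) auto
  qed auto
  ultimately show ?thesis
    by (simp add: F2_subgroup subgroup_lattice_def)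
qed

text \<open>Images under \<open>h\<close> and under its inverse are mutually inverse maps between
  the two sets of factorizing pairs.\<close>

lemma F2_iso:
  assumes G: "group G" and G': "group G'" and h: "h \<in> iso G G'"
  shows "F2 G' = F2 G"
proof -
  define S where "S = {(H, K) \<in> subgroup_lattice G \<times> subgroup_lattice G. H <#>\<^bsub>G\<^esub> K = carrier G}"
  define S' where
    "S' = {(H, K) \<in> subgroup_lattice G' \<times> subgroup_lattice G'. H <#>\<^bsub>G'\<^esub> K = carrier G'}"
  let ?g = "inv_into (carrier G) h"
  have g: "?g \<in> iso G' G"
    using group.iso_set_sym[OF G h] .
  have bij: "bij_betw h (carrier G) (carrier G')"
    using h by (simp add: iso_def)
  \<comment> \<open>\<open>inv_into\<close> inverts \<open>h\<close> only between the carriers,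
    hence the restriction to their subsets.\<close>
  have hg: "h ` ?g ` X = X" if "X \<subseteq> carrier G'" for X
    using bij that by (auto simp: image_image f_inv_into_f bij_betw_def subset_iff image_iff)
  have gh: "?g ` h ` X = X" if "X \<subseteq> carrier G" for X
    using bij that by (simp add: inv_into_image_cancel bij_betw_def)
  have "bij_betw (map_prod (image h) (image h)) (S) (S')"
  proof (rule bij_betw_byWitness[where f' = "map_prod (image ?g) (image ?g)"])
    show "\<forall>p\<in>S. map_prod (image ?g) (image ?g) (map_prod (image h) (image h) p) = p"
      by (auto simp: S_def subgroup_lattice_def gh subgroup.subset)
    show "\<forall>p\<in>S'. map_prod (image h) (image h) (map_prod (image ?g) (image ?g) p) = p"
      by (auto simp: S'_def subgroup_lattice_def hg subgroup.subset)
    show "map_prod (image h) (image h) ` S \<subseteq> S'"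
    proof (clarsimp simp: S_def S'_def subgroup_lattice_def)
      fix H K assume HK: "subgroup H G" "subgroup K G" "H <#>\<^bsub>G\<^esub> K = carrier G"
      then show "subgroup (h ` H) G' \<and> subgroup (h ` K) G' \<and> h ` H <#>\<^bsub>G'\<^esub> h ` K = carrier G'"
        using set_mult_hom[of h G G' H K] h bij subgroup.iso_subgroup[OF _ G G' h]
        by (simp add: iso_def bij_betw_def subgroup.subset)
    qed
    show "map_prod (image ?g) (image ?g) ` S' \<subseteq> S"
    proof (clarsimp simp: S_def S'_def subgroup_lattice_def)
      fix H K assume HK: "subgroup H G'" "subgroup K G'" "H <#>\<^bsub>G'\<^esub> K = carrier G'"
      then show "subgroup (?g ` H) G \<and> subgroup (?g ` K) G \<and> ?g ` H <#>\<^bsub>G\<^esub> ?g ` K = carrier G"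
        using set_mult_hom[of ?g G' G H K] g subgroup.iso_subgroup[OF _ G' G g]
        by (simp add: iso_def bij_betw_def subgroup.subset)
    qed
  qed
  then show ?thesis
    unfolding F2_def S_def S'_def by (rule bij_betw_same_card[symmetric])
qed

text \<open>Meant for \<open>G' = G\<close> and a conjugation \<open>h\<close>: conjugate subgroups
  have the same factorization number.\<close>

lemma (in group) F2_image_iso:
  assumes G': "group G'" and h: "h \<in> iso G G'" and M: "subgroup M G"
  shows "F2 (G'\<lparr>carrier := h ` M\<rparr>) = F2 (G\<lparr>carrier := M\<rparr>)"
proof (rule F2_iso)
  show "group (G\<lparr>carrier := M\<rparr>)"
    using M by (rule subgroup_imp_group)
  show "group (G'\<lparr>carrier := h ` M\<rparr>)"
    using group.subgroup_imp_group[OF G' subgroup.iso_subgroup[OF M group_axioms G' h]] .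
  show "h \<in> iso (G\<lparr>carrier := M\<rparr>) (G'\<lparr>carrier := h ` M\<rparr>)"
    using h subgroup.subset[OF M]
    by (auto simp: iso_def hom_def bij_betw_def subset_iff intro: inj_on_subset)
qed

lemma (in group) conjugation_iso:
  assumes x: "x \<in> carrier G"
  shows "(\<lambda>g. inv x \<otimes> g \<otimes> x) \<in> iso G G"
proof (rule isoI)
  have cancel: "x \<otimes> (inv x \<otimes> g) = g" "inv x \<otimes> (x \<otimes> g) = g" if "g \<in> carrier G" for g
    using x that by (simp_all flip: m_assoc)
  show "(\<lambda>g. inv x \<otimes> g \<otimes> x) \<in> hom G G"
    using x by (auto simp: hom_def m_assoc cancel)
  show "bij_betw (\<lambda>g. inv x \<otimes> g \<otimes> x) (carrier G) (carrier G)"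
    using x by (intro bij_betw_byWitness[where f' = "\<lambda>g. x \<otimes> g \<otimes> inv x"])
      (auto simp: m_assoc cancel)
qed

section \<open>Groups given by generators and relations\<close>

text \<open>The rules \<open>cancel\<close> and \<open>relation\<close> act inside an arbitrary
  context, so equality of words survives enlarging the context; the two factors are then exchanged
  one after the other.\<close>

lemma word_eq_append:
  assumes "word_eq R u u'" "word_eq R v v'"
  shows "word_eq R (u @ v) (u' @ v')"
proof -
  have "word_eq R (x @ w @ y) (x @ w' @ y)" if "word_eq R w w'" for x y w w'
    using that
  proof induction
    case (cancel u z e v)
    show ?case using word_eq.cancel[of R "x @ u" z e "v @ y"] by simp
  next
    case (relation s t u v)
    then show ?case using word_eq.relation[of s t R "x @ u" "v @ y"] by simp
  qed (auto intro: word_eq.intros)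
  from this[OF assms(1), of "[]" v] this[OF assms(2), of u' "[]"] show ?thesis
    by (auto intro: word_eq.trans)
qed

lemma word_class_eq_iff: "word_class R u = word_class R v \<longleftrightarrow> word_eq R u v"
  unfolding word_class_def
  by (auto dest: word_eq.sym intro: word_eq.refl word_eq.trans simp: set_eq_iff)

lemma presented_group_carrier: "carrier (presented_group R) = range (word_class R)"
  by (simp add: presented_group_def)

lemma presented_group_one: "\<one>\<^bsub>presented_group R\<^esub> = word_class R []"
  by (simp add: presented_group_def)

text \<open>The double union that defines the product collapses, because all its members are the
  same class.\<close>

lemma presented_group_mult:
  "word_class R u \<otimes>\<^bsub>presented_group R\<^esub> word_class R v = word_class R (u @ v)"
proof -
  have "word_class R (u' @ v') = word_class R (u @ v)"
    if "u' \<in> word_class R u" "v' \<in> word_class R v" for u' v'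
    using that unfolding word_class_eq_iff
    by (simp add: word_class_def word_eq_append word_eq.sym)
  moreover have "w \<in> word_class R w" for w
    by (simp add: word_class_def word_eq.refl)
  ultimately have "(\<Union>u'\<in>word_class R u. \<Union>v'\<in>word_class R v. word_class R (u' @ v'))
    = word_class R (u @ v)"
    by blast
  then show ?thesis
    by (simp add: presented_group_def)
qed

lemma group_presented_group: "group (presented_group R)"
proof (rule groupI)
  fix X assume "X \<in> carrier (presented_group R)"
  then obtain u where u: "X = word_class R u"
    by (auto simp: presented_group_carrier)
  \<comment> \<open>The formal inverse reverses the word and flips every flag; the two letters that
    meet in the middle cancel.\<close>
  have "word_eq R (rev (map (apsnd Not) u) @ u) []"
  proof (induction u)
    case (Cons l u)
    obtain x e where l: "l = (x, e)" by (cases l)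
    have "word_eq R (rev (map (apsnd Not) u) @ [(x, \<not> e), (x, \<not> \<not> e)] @ u)
      (rev (map (apsnd Not) u) @ u)"
      by (rule word_eq.cancel)
    with Cons show ?case by (auto simp: l intro: word_eq.trans)
  qed (simp add: word_eq.refl)
  then show "\<exists>Y\<in>carrier (presented_group R). Y \<otimes>\<^bsub>presented_group R\<^esub> X = \<one>\<^bsub>presented_group R\<^esub>"
    unfolding u presented_group_carrier
    by (intro bexI[of _ "word_class R (rev (map (apsnd Not) u))"])
      (auto simp: presented_group_mult presented_group_one word_class_eq_iff)
qed (auto simp: presented_group_carrier presented_group_one presented_group_mult)

section \<open>Subgroups of a group with a metacyclic normal form\<close>

text \<open>In a finite group the inverse of an element is one of its positive powers.\<close>

lemma (in group) finite_closed_imp_subgroup: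
  assumes fin: "finite (carrier G)" and S: "S \<subseteq> carrier G" "S \<noteq> {}"
    and closed: "\<And>x y. x \<in> S \<Longrightarrow> y \<in> S \<Longrightarrow> x \<otimes> y \<in> S"
  shows "subgroup S G"
proof (rule subgroupI)
  fix x assume x: "x \<in> S"
  have pow: "x [^] Suc k \<in> S" for k :: nat
    by (induction k) (use x S closed in auto)
  have order: "order G > 0"
    using fin by (simp add: order_gt_0_iff_finite)
  \<comment> \<open>Doubling the order keeps the exponent positive even in the trivial group, so
    that it is a successor as \<open>pow\<close> requires.\<close>
  have "x [^] (order G * 2 - 1) \<otimes> x = x [^] (order G * 2)"
    using x S order by (simp flip: nat_pow_Suc)
  also have "\<dots> = \<one>"
    using x S by (simp add: subsetD pow_order_eq_1 flip: nat_pow_pow)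
  finally have "inv x = x [^] (order G * 2 - 1)"
    using x S by (intro inv_equality) auto
  also have "order G * 2 - 1 = Suc (order G * 2 - 2)"
    using order by simp
  finally show "inv x \<in> S"
    using pow by simp
qed (use S closed in auto)

text \<open>Saturation modulo \<open>n\<close> makes \<open>X\<close> the preimage of a subgroup of
  the integers modulo \<open>n\<close>; its least positive element generates it.\<close>

lemma additive_mod_closed_eq_multiples:
  fixes X :: "nat set"
  assumes n: "n > 0" and zero: "0 \<in> X"
    and add: "\<And>x y. x \<in> X \<Longrightarrow> y \<in> X \<Longrightarrow> x + y \<in> X"
    and cong: "\<And>x y. x \<in> X \<Longrightarrow> [x = y] (mod n) \<Longrightarrow> y \<in> X"
  obtains d where "d dvd n" "X = {x. d dvd x}"
proof -
  define d where "d = (LEAST d. d > 0 \<and> d \<in> X)"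
  have nX: "n \<in> X"
    using cong[OF zero, of n] by (simp add: cong_def)
  have d: "d > 0" "d \<in> X"
    unfolding d_def by (rule LeastI2[of _ n]; use n nX in simp)+
  have mult: "d * k \<in> X" for k
    by (induction k) (use zero add d in auto)
  have dvd: "d dvd x" if "x \<in> X" for x
  proof -
    \<comment> \<open>Adding \<open>n - 1\<close> copies of a number subtracts it modulo
      \<open>n\<close>. So the remainder \<open>x mod d\<close> is in \<open>X\<close>, and
      minimality of \<open>d\<close> makes it zero.\<close>
    have "[x + d * ((n - 1) * (x div d)) = x mod d] (mod n)"
    proof -
      have "x + d * ((n - 1) * (x div d)) = x mod d + d * (x div d) + d * ((n - 1) * (x div d))"
        by simp
      also have "\<dots> = x mod d + n * (d * (x div d))"
        using n by (cases n) (simp_all add: algebra_simps)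
      finally show ?thesis
        by (simp add: cong_def)
    qed
    then have "x mod d \<in> X"
      using cong add mult that by blast
    moreover have "x mod d < d" using d by simp
    ultimately have "x mod d = 0"
      using not_less_Least[of "x mod d" "\<lambda>d. d > 0 \<and> d \<in> X"] unfolding d_def by auto
    then show ?thesis by auto
  qed
  show ?thesis
  proof (rule that[of d])
    show "d dvd n" using nX by (rule dvd)
    show "X = {x. d dvd x}" using dvd mult by (auto elim: dvdE)
  qed
qed

text \<open>The difference \<open>x - y\<close> may be truncated in \<open>nat\<close>. Adding
  \<open>m * y\<close> to \<open>x\<close> keeps its class modulo \<open>m\<close> and makes the
  subtraction exact.\<close>

lemma cong_dvd_lift:
  fixes x y :: nat
  assumes "m > 0" "d dvd m" "[x = y] (mod d)"
  obtains t where "[x = y + d * t] (mod m)"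
proof -
  have "[x + m * y = y] (mod d)"
    using assms by (metis cong_add_rcancel_0_nat cong_0_iff cong_trans dvd_mult2 cong_sym
        cong_add cong_refl add_0_right)
  moreover have "y \<le> x + m * y"
    using assms by (cases m) auto
  ultimately have "d dvd x + m * y - y"
    using cong_altdef_nat by blast
  then obtain t where "x + m * y - y = d * t" ..
  then have "y + d * t = x + m * y"
    using \<open>y \<le> x + m * y\<close> by simp
  then show ?thesis
    by (intro that[of t]) (simp add: cong_def)
qed

lemma geometric_sum_add:
  fixes q :: nat
  shows "(\<Sum>t<k + l. q ^ t) = (\<Sum>t<k. q ^ t) * q ^ l + (\<Sum>t<l. q ^ t)"
proof -
  have "(\<Sum>t<l + k. q ^ t) = (\<Sum>t<k. q ^ t) * q ^ l + (\<Sum>t<l. q ^ t)"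
    by (induction k) (simp_all add: algebra_simps power_add)
  then show ?thesis by (simp add: add.commute)
qed

lemma geometric_sum_dvd:
  fixes q :: nat
  shows "(\<Sum>t<k. q ^ t) dvd (\<Sum>t<k * l. q ^ t)"
  by (induction l) (simp_all add: geometric_sum_add)

text \<open>The element \<open>el j i\<close> plays the role of \<open>b^j a^i\<close>.\<close>

locale zm_group = group G for G (structure) +
  fixes m n r :: nat and el :: "nat \<Rightarrow> nat \<Rightarrow> 'a"
  assumes m_pos: "m > 0" and n_pos: "n > 0" and coprime_m_n: "coprime m n"
    and r_pow_n: "[r ^ n = 1] (mod m)"
    and carrier_el: "carrier G = range (case_prod el)"
    and el_mult: "el j i \<otimes> el k l = el (j + k) (i * r ^ k + l)"
    and el_eq_iff: "el j i = el k l \<longleftrightarrow> [j = k] (mod n) \<and> [i = l] (mod m)"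
begin

text \<open>
  \<open>norm_sum n1\<close> is \<open>(r^n - 1) / (r^n1 - 1)\<close>: the exponent of \<open>a\<close> in \<open>(b^n1 a)^(n / n1)\<close>.
\<close>

definition norm_sum :: "nat \<Rightarrow> nat"
  where "norm_sum n1 = (\<Sum>t<n div n1. (r ^ n1) ^ t)"

definition zm_subgroup :: "nat \<Rightarrow> nat \<Rightarrow> nat \<Rightarrow> 'a set"
  where "zm_subgroup m1 n1 s = generate G {el 0 m1, el n1 s}"

lemma el_closed [simp]: "el j i \<in> carrier G"
  by (force simp: carrier_el)

lemma el_cases:
  assumes "g \<in> carrier G"
  obtains j i where "g = el j i"
  using assms by (auto simp: carrier_el)

lemma finite_carrier: "finite (carrier G)"
proof (rule finite_subset)
  show "carrier G \<subseteq> case_prod el ` ({..<n} \<times> {..<m})"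
  proof
    fix g assume "g \<in> carrier G"
    then obtain j i where "g = el j i" by (rule el_cases)
    also have "\<dots> = el (j mod n) (i mod m)"
      by (simp add: el_eq_iff)
    finally show "g \<in> case_prod el ` ({..<n} \<times> {..<m})"
      using m_pos n_pos by force
  qed
qed simp

lemma el_0_0: "el 0 0 = \<one>"
  using el_mult[of 0 0 0 0] by (simp add: r_cancel_one)

lemma el_pow: "el j i [^] k = el (j * k) (i * (\<Sum>t<k. (r ^ j) ^ t))"
proof (induction k)
  case 0
  show ?case by (simp add: el_0_0)
next
  case (Suc k)
  then show ?case
    using geometric_sum_add[of "r ^ j" k 1] by (simp add: el_mult algebra_simps)
qed

lemma zm_subgroup_subgroup: "subgroup (zm_subgroup m1 n1 s) G"
  unfolding zm_subgroup_def by (rule generate_is_subgroup) simp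

lemma zm_subgroup_generators: "el 0 m1 \<in> zm_subgroup m1 n1 s" "el n1 s \<in> zm_subgroup m1 n1 s"
  unfolding zm_subgroup_def by (auto intro: generate.incl)

lemma zm_subgroup_subset: "subgroup K G \<Longrightarrow> el 0 m1 \<in> K \<Longrightarrow> el n1 s \<in> K \<Longrightarrow> zm_subgroup m1 n1 s \<subseteq> K"
  unfolding zm_subgroup_def by (rule generate_subgroup_incl) auto

lemma subgroup_pow_closed: "subgroup K G \<Longrightarrow> x \<in> K \<Longrightarrow> x [^] (k :: nat) \<in> K"
  by (induction k) (auto intro: subgroup.one_closed subgroup.m_closed)

text \<open>Modulo \<open>m\<close> the two exponents differ by a multiple of \<open>m1\<close>,
  which right multiplication by a power of \<open>el 0 m1\<close> supplies.\<close>

lemma mem_subgroup_cong: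
  assumes "subgroup K G" "m1 dvd m" "el 0 m1 \<in> K" "el j x \<in> K" "[x = y] (mod m1)"
  shows "el j y \<in> K"
proof -
  obtain t where t: "[y = x + m1 * t] (mod m)"
    using cong_dvd_lift[OF m_pos \<open>m1 dvd m\<close> cong_sym[OF assms(5)]] .
  have "el j x \<otimes> el 0 m1 [^] t \<in> K"
    using assms by (simp add: subgroup.m_closed subgroup_pow_closed)
  also have "el j x \<otimes> el 0 m1 [^] t = el j y"
    using cong_sym[OF t] by (simp add: el_pow el_mult el_eq_iff)
  finally show ?thesis .
qed

lemma zm_subgroup_cong:
  assumes "m1 dvd m" "[s = s'] (mod m1)"
  shows "zm_subgroup m1 n1 s = zm_subgroup m1 n1 s'"
proof -
  have "zm_subgroup m1 n1 x \<subseteq> zm_subgroup m1 n1 y" if "[x = y] (mod m1)" for x y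
    using mem_subgroup_cong[OF zm_subgroup_subgroup assms(1) zm_subgroup_generators cong_sym[OF that]]
    by (intro zm_subgroup_subset zm_subgroup_subgroup zm_subgroup_generators)
  then show ?thesis
    using assms(2) cong_sym by blast
qed

section \<open>Membership in the subgroups \<open>zm_subgroup m1 n1 s\<close>\<close>

context
  fixes m1 n1 s :: nat
  assumes m1: "m1 dvd m" and n1: "n1 dvd n" and s: "m1 dvd s * norm_sum n1"
begin

text \<open>If \<open>n1 * k\<close> and \<open>n1 * l\<close> agree modulo \<open>n\<close>, the
  numbers of terms differ by a multiple of \<open>n div n1\<close>. The extra block of terms is a
  multiple of \<open>norm_sum n1\<close>, which assumption \<open>s\<close> kills after
  multiplication by \<open>s\<close>.\<close>

lemma sum_cong:
  assumes "[n1 * k = n1 * l] (mod n)"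
  shows "[s * (\<Sum>t<k. (r ^ n1) ^ t) = s * (\<Sum>t<l. (r ^ n1) ^ t)] (mod m1)"
proof -
  have *: "[s * (\<Sum>t<k. (r ^ n1) ^ t) = s * (\<Sum>t<l. (r ^ n1) ^ t)] (mod m1)"
    if kl: "[n1 * k = n1 * l] (mod n)" "k \<le> l" for k l
  proof -
    have pos: "n1 > 0" using n1 n_pos by (auto intro: dvd_pos_nat)
    have "n dvd n1 * l - n1 * k"
      using kl by (subst (asm) cong_sym_eq) (simp add: cong_altdef_nat)
    then have "n1 * (n div n1) dvd n1 * (l - k)"
      using n1 by (simp add: right_diff_distrib')
    then have "n div n1 dvd l - k"
      using pos by simp
    then obtain c where c: "l - k = n div n1 * c" ..
    then have l: "l = n div n1 * c + k" using kl by simp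
    have "m1 dvd s * (\<Sum>t<n div n1 * c. (r ^ n1) ^ t)"
      using s geometric_sum_dvd[of "r ^ n1" "n div n1" c] unfolding norm_sum_def
      by (meson dvd_trans mult_dvd_mono dvd_refl)
    then have "[s * (\<Sum>t<n div n1 * c. (r ^ n1) ^ t) * (r ^ n1) ^ k + s * (\<Sum>t<k. (r ^ n1) ^ t)
      = 0 + s * (\<Sum>t<k. (r ^ n1) ^ t)] (mod m1)"
      by (intro cong_add cong_refl) (simp add: cong_0_iff)
    then show ?thesis
      unfolding l geometric_sum_add by (simp add: algebra_simps cong_sym_eq)
  qed
  show ?thesis
    using *[of k l] *[of l k] assms by (cases "k \<le> l") (auto simp: cong_sym_eq)
qed

text \<open>The elements satisfying the congruence form a set \<open>S\<close> that is closed under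
  products by \<open>geometric_sum_add\<close> and contains both generators. One element has several
  representations \<open>el (n1 * k) y\<close>; \<open>sum_cong\<close> makes the congruence
  independent of the choice.\<close>

lemma mem_zm_subgroup_iff: "el (n1 * k) x \<in> zm_subgroup m1 n1 s \<longleftrightarrow> [x = s * (\<Sum>t<k. (r ^ n1) ^ t)] (mod m1)"
  and mem_zm_subgroup_dvd: "el j x \<in> zm_subgroup m1 n1 s \<Longrightarrow> n1 dvd j"
proof -
  define S where "S = (\<lambda>(k, x). el (n1 * k) x) ` {(k, x). [x = s * (\<Sum>t<k. (r ^ n1) ^ t)] (mod m1)}"
  have S_I: "el (n1 * k) x \<in> S" if "[x = s * (\<Sum>t<k. (r ^ n1) ^ t)] (mod m1)" for k x
    using that unfolding S_def by force
  have S_E: thesis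
    if "g \<in> S" "\<And>k x. g = el (n1 * k) x \<Longrightarrow> [x = s * (\<Sum>t<k. (r ^ n1) ^ t)] (mod m1) \<Longrightarrow> thesis"
    for g thesis
    using that unfolding S_def by force
  have "subgroup S G"
  proof (rule finite_closed_imp_subgroup[OF finite_carrier])
    show "S \<subseteq> carrier G" by (auto elim: S_E)
    show "S \<noteq> {}" using S_I[OF cong_refl] by blast
    fix g h assume "g \<in> S" "h \<in> S"
    then obtain k x l y where g: "g = el (n1 * k) x" "[x = s * (\<Sum>t<k. (r ^ n1) ^ t)] (mod m1)"
      and h: "h = el (n1 * l) y" "[y = s * (\<Sum>t<l. (r ^ n1) ^ t)] (mod m1)"
      by (elim S_E)
    have "[x * (r ^ n1) ^ l + y = s * (\<Sum>t<k. (r ^ n1) ^ t) * (r ^ n1) ^ l + s * (\<Sum>t<l. (r ^ n1) ^ t)] (mod m1)"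
      using g h by (intro cong_add cong_mult cong_refl)
    also have "s * (\<Sum>t<k. (r ^ n1) ^ t) * (r ^ n1) ^ l + s * (\<Sum>t<l. (r ^ n1) ^ t)
      = s * (\<Sum>t<k + l. (r ^ n1) ^ t)"
      by (simp add: geometric_sum_add algebra_simps)
    finally have "[x * (r ^ n1) ^ l + y = s * (\<Sum>t<k + l. (r ^ n1) ^ t)] (mod m1)" .
    moreover have "g \<otimes> h = el (n1 * (k + l)) (x * (r ^ n1) ^ l + y)"
      by (simp add: g(1) h(1) el_mult power_mult distrib_left)
    ultimately show "g \<otimes> h \<in> S" using S_I by simp
  qed
  then have sub: "zm_subgroup m1 n1 s \<subseteq> S"
  proof (rule zm_subgroup_subset)
    show "el 0 m1 \<in> S"
    proof -
      have "el 0 m1 = el (n1 * 0) m1" "[m1 = s * (\<Sum>t<0. (r ^ n1) ^ t)] (mod m1)"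
        by (simp_all add: cong_def)
      then show ?thesis using S_I by metis
    qed
    show "el n1 s \<in> S"
    proof -
      have "el n1 s = el (n1 * 1) s" "[s = s * (\<Sum>t<1. (r ^ n1) ^ t)] (mod m1)"
        by simp_all
      then show ?thesis using S_I by metis
    qed
  qed
  show "n1 dvd j" if j: "el j x \<in> zm_subgroup m1 n1 s"
  proof -
    obtain k y where "el j x = el (n1 * k) y"
      using sub j by (blast elim: S_E)
    then have "[j = n1 * k] (mod n)"
      by (simp add: el_eq_iff)
    then have "[j = n1 * k] (mod n1)"
      using n1 by (rule cong_dvd_modulus_nat)
    then show ?thesis
      by (simp add: cong_def mod_eq_0_iff_dvd)
  qed
  show "el (n1 * k) x \<in> zm_subgroup m1 n1 s \<longleftrightarrow> [x = s * (\<Sum>t<k. (r ^ n1) ^ t)] (mod m1)"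
  proof
    assume "el (n1 * k) x \<in> zm_subgroup m1 n1 s"
    then obtain l y where ly: "el (n1 * k) x = el (n1 * l) y"
      "[y = s * (\<Sum>t<l. (r ^ n1) ^ t)] (mod m1)"
      using sub by (blast elim: S_E)
    then have "[x = y] (mod m)" "[n1 * k = n1 * l] (mod n)"
      by (simp_all add: el_eq_iff)
    moreover from this(1) have "[x = y] (mod m1)"
      using m1 by (rule cong_dvd_modulus_nat)
    ultimately show "[x = s * (\<Sum>t<k. (r ^ n1) ^ t)] (mod m1)"
      using ly(2) sum_cong[of k l] by (meson cong_trans cong_sym)
  next
    assume *: "[x = s * (\<Sum>t<k. (r ^ n1) ^ t)] (mod m1)"
    have "el n1 s [^] k \<in> zm_subgroup m1 n1 s"
      by (intro subgroup_pow_closed zm_subgroup_subgroup zm_subgroup_generators)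
    then show "el (n1 * k) x \<in> zm_subgroup m1 n1 s"
      unfolding el_pow
      by (rule mem_subgroup_cong[OF zm_subgroup_subgroup m1 zm_subgroup_generators(1)]) (rule cong_sym[OF *])
  qed
qed

lemma mem_zm_subgroup_0_iff: "el 0 x \<in> zm_subgroup m1 n1 s \<longleftrightarrow> m1 dvd x"
  using mem_zm_subgroup_iff[of 0 x] by (simp add: cong_0_iff)

end

section \<open>Classification of all subgroups by their parameters\<close>

definition params :: "(nat \<times> nat \<times> nat) set"
  where "params = (SIGMA m1:{m1. m1 dvd m}. SIGMA n1:{n1. n1 dvd n}. {s. s < m1 \<and> m1 dvd s * norm_sum n1})"

text \<open>A subgroup determines its parameters: \<open>m1\<close> through the powers of
  \<open>a\<close> in it, \<open>n1\<close> through the exponents of \<open>b\<close> that occur,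
  and \<open>s\<close> modulo \<open>m1\<close> through the elements whose exponent of
  \<open>b\<close> is \<open>n1\<close>.\<close>

lemma zm_subgroup_inj: "inj_on (\<lambda>(m1, n1, s). zm_subgroup m1 n1 s) params"
proof (rule inj_onI)
  fix p p' assume p: "p \<in> params" "p' \<in> params" "(\<lambda>(m1, n1, s). zm_subgroup m1 n1 s) p = (\<lambda>(m1, n1, s). zm_subgroup m1 n1 s) p'"
  obtain m1 n1 s m2 n2 t where pp': "p = (m1, n1, s)" "p' = (m2, n2, t)"
    by (metis prod_cases3)
  have 1: "(m1, n1, s) \<in> params" and 2: "(m2, n2, t) \<in> params" and eq: "zm_subgroup m1 n1 s = zm_subgroup m2 n2 t"
    using p by (simp_all add: pp')
  have v1: "m1 dvd m" "n1 dvd n" "m1 dvd s * norm_sum n1" "s < m1"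
    and v2: "m2 dvd m" "n2 dvd n" "m2 dvd t * norm_sum n2" "t < m2"
    using 1 2 by (auto simp: params_def)
  have "m1 = m2"
    using zm_subgroup_generators(1)[of m1 n1 s] zm_subgroup_generators(1)[of m2 n2 t] eq v1 v2
    by (metis mem_zm_subgroup_0_iff dvd_antisym)
  moreover have "n1 = n2"
    using zm_subgroup_generators(2)[of n1 s m1] zm_subgroup_generators(2)[of n2 t m2] eq v1 v2
    by (metis mem_zm_subgroup_dvd dvd_antisym)
  moreover have "s = t"
    using zm_subgroup_generators(2)[of n1 s m1] mem_zm_subgroup_iff[OF v2(1-3), of 1 s] v1(4) v2(4) eq
    by (simp add: calculation cong_less_modulus_unique_nat)
  ultimately show "p = p'" by (simp add: pp')
qed

text \<open>Here \<open>m1\<close> generates the exponents of the powers of \<open>a\<close> in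
  \<open>H\<close>, \<open>n1\<close> generates the exponents of \<open>b\<close> that occur in
  \<open>H\<close>, and \<open>s\<close> comes from any element of \<open>H\<close> whose exponent
  of \<open>b\<close> is \<open>n1\<close>.\<close>

lemma zm_subgroup_surj:
  assumes H: "subgroup H G"
  shows "\<exists>p\<in>params. H = (\<lambda>(m1, n1, s). zm_subgroup m1 n1 s) p"
proof -
  note closed = subgroup.m_closed[OF H]
  have one: "el 0 0 \<in> H"
    using subgroup.one_closed[OF H] by (simp add: el_0_0)
  have congH: "el k y \<in> H" if "el j x \<in> H" "[j = k] (mod n)" "[x = y] (mod m)" for j x k y
    using that el_eq_iff by metis
  obtain m1 where m1: "m1 dvd m" "{x. el 0 x \<in> H} = {x. m1 dvd x}"
  proof (rule additive_mod_closed_eq_multiples[OF m_pos, of "{x. el 0 x \<in> H}"])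
    show "x + y \<in> {x. el 0 x \<in> H}" if "x \<in> {x. el 0 x \<in> H}" "y \<in> {x. el 0 x \<in> H}" for x y
      using closed[of "el 0 x" "el 0 y"] that by (simp add: el_mult)
  qed (use one congH in auto)
  obtain n1 where n1: "n1 dvd n" "{j. \<exists>x. el j x \<in> H} = {x. n1 dvd x}"
  proof (rule additive_mod_closed_eq_multiples[OF n_pos, of "{j. \<exists>x. el j x \<in> H}"])
    show "j + k \<in> {j. \<exists>x. el j x \<in> H}"
      if "j \<in> {j. \<exists>x. el j x \<in> H}" "k \<in> {j. \<exists>x. el j x \<in> H}" for j k
      using closed that by (auto simp: el_mult dest!: meta_spec)
        (metis closed el_mult)
    show "k \<in> {j. \<exists>x. el j x \<in> H}" if "j \<in> {j. \<exists>x. el j x \<in> H}" "[j = k] (mod n)" for j k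
      using congH[OF _ that(2) cong_refl] that(1) by blast
  qed (use one in blast)
  have m1_iff: "el 0 x \<in> H \<longleftrightarrow> m1 dvd x" for x
    using m1(2) by (simp add: set_eq_iff)
  have n1_iff: "(\<exists>x. el j x \<in> H) \<longleftrightarrow> n1 dvd j" for j
    using n1(2) by (simp add: set_eq_iff)
  obtain s0 where s0: "el n1 s0 \<in> H"
    using n1_iff[of n1] by auto
  define s where "s = s0 mod m1"
  have m1_pos: "m1 > 0" using m1 m_pos by (auto intro: dvd_pos_nat)
  have el_m1: "el 0 m1 \<in> H" by (simp add: m1_iff)
  have el_s: "el n1 s \<in> H"
    using mem_subgroup_cong[OF H m1(1) el_m1 s0] by (simp add: s_def)
  \<comment> \<open>The part in \<open>b\<close> of this power is trivial, so it is a power of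
    \<open>a\<close> in \<open>H\<close>; this yields the divisibility required in
    \<open>params\<close>.\<close>
  have "el n1 s [^] (n div n1) \<in> H"
    using el_s by (rule subgroup_pow_closed[OF H])
  then have "el 0 (s * norm_sum n1) \<in> H"
    using n1(1) congH[of n] by (simp add: el_pow norm_sum_def cong_def)
  then have valid: "m1 dvd s * norm_sum n1"
    by (simp add: m1_iff)
  have "H \<subseteq> zm_subgroup m1 n1 s"
  proof
    fix g assume g: "g \<in> H"
    then obtain j x where jx: "g = el j x"
      using el_cases subgroup.mem_carrier[OF H] by metis
    then have "n1 dvd j" using g n1_iff by metis
    then obtain k where k: "j = n1 * k" ..
    \<comment> \<open>The \<open>k\<close>-th power of \<open>el n1 s\<close> has the same exponent
      of \<open>b\<close> as \<open>g\<close>. The quotient of the two is a power of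
      \<open>a\<close> in \<open>H\<close>, so its exponent is a multiple of
      \<open>m1\<close>.\<close>
    let ?y = "s * (\<Sum>t<k. (r ^ n1) ^ t)"
    have y: "el j ?y \<in> H"
      using subgroup_pow_closed[OF H el_s, of k] by (simp add: el_pow k)
    obtain t where t: "[x = ?y + 1 * t] (mod m)"
      by (rule cong_dvd_lift[OF m_pos, of 1 x ?y]) auto
    have "el j ?y \<otimes> el 0 t = g"
      using cong_sym[OF t] by (simp add: el_mult jx el_eq_iff)
    then have "el 0 t = inv (el j ?y) \<otimes> g"
      by (metis el_closed inv_solve_left' jx)
    then have "el 0 t \<in> H"
      using y g by (simp add: closed subgroup.m_inv_closed[OF H])
    then have "m1 dvd t" by (simp add: m1_iff)
    then have "[x = ?y] (mod m1)"
      using cong_dvd_modulus_nat[OF t m1(1)] by (auto simp: cong_def mod_add_eq[of _ t, symmetric])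
    then show "g \<in> zm_subgroup m1 n1 s"
      using mem_zm_subgroup_iff[OF m1(1) n1(1) valid] by (simp add: jx k)
  qed
  moreover have "zm_subgroup m1 n1 s \<subseteq> H"
    by (rule zm_subgroup_subset[OF H el_m1 el_s])
  moreover have "(m1, n1, s) \<in> params"
    using m1(1) n1(1) valid m1_pos by (simp add: params_def s_def)
  ultimately show ?thesis by force
qed

lemma bij_betw_zm_subgroup: "bij_betw (\<lambda>(m1, n1, s). zm_subgroup m1 n1 s) params (subgroup_lattice G)"
  unfolding bij_betw_def subgroup_lattice_def
  using zm_subgroup_inj zm_subgroup_surj zm_subgroup_subgroup by (auto simp: image_iff)

text \<open>Conjugation by \<open>el 0 x\<close> fixes \<open>el 0 m1\<close> and turns
  \<open>el n1 0\<close> into an element whose exponent of \<open>a\<close> is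
  \<open>x (1 - r^n1)\<close>; it suffices that this equals \<open>s\<close> modulo
  \<open>m1\<close>.\<close>

lemma zm_subgroup_conjugate:
  assumes m1: "m1 dvd m" and n1: "n1 dvd n" and s: "m1 dvd s * norm_sum n1"
  obtains x where "x \<in> carrier G" "zm_subgroup m1 n1 s = (\<lambda>g. inv x \<otimes> g \<otimes> x) ` zm_subgroup m1 n1 0"
proof -
  define q where "q = int r ^ n1"
  define d where "d = gcd (q - 1) (int m1)"
  have "[q = 1] (mod d)"
    by (simp add: d_def cong_iff_dvd_diff)
  then have "[(\<Sum>t<n div n1. q ^ t) = (\<Sum>t<n div n1. 1 ^ t)] (mod d)"
    by (intro cong_sum cong_pow)
  then have "[int (norm_sum n1) = int (n div n1)] (mod d)"
    by (simp add: norm_sum_def q_def)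
  moreover have "coprime d (int (n div n1))"
  proof (rule coprime_divisors)
    show "d dvd int m" using m1 by (auto simp: d_def intro: dvd_trans)
    show "int (n div n1) dvd int n"
      using n1 by (metis dvd_div_mult_self dvd_triv_left int_dvd_int_iff)
    show "coprime (int m) (int n)" using coprime_m_n by simp
  qed
  ultimately have "coprime d (int (norm_sum n1))"
    by (metis cong_imp_coprime cong_sym coprime_commute)
  moreover have "d dvd int s * int (norm_sum n1)"
    using s by (metis d_def dvd_trans gcd_dvd2 int_dvd_int_iff of_nat_mult)
  ultimately have "d dvd int s"
    using coprime_dvd_mult_left_iff by blast
  then obtain c where c: "int s = d * c" ..
  \<comment> \<open>\<open>u\<close> is a Bezout coefficient of \<open>q - 1\<close>. Its product
    with the cofactor \<open>c\<close>, with the sign changed, solves the congruence; reduction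
    modulo \<open>m\<close> makes it a natural number.\<close>
  obtain u where u: "[(q - 1) * u = d] (mod int m1)"
    using cong_solve_int[of "q - 1" "int m1"] unfolding d_def by blast
  define x where "x = nat ((- u * c) mod int m)"
  have x: "[int x = - u * c] (mod int m1)"
    using m1 m_pos by (simp add: x_def cong_def mod_mod_cancel)
  have "[int x * q + int s = int x * q + (q - 1) * u * c] (mod int m1)"
    unfolding c using u by (intro cong_add cong_mult cong_refl cong_sym[OF u])
  also have "[int x * q + (q - 1) * u * c = (- u * c) * q + (q - 1) * u * c] (mod int m1)"
    by (intro cong_add cong_mult cong_refl x)
  also have "(- u * c) * q + (q - 1) * u * c = - u * c"
    by (simp add: algebra_simps)
  also have "[- u * c = int x] (mod int m1)"
    using x by (rule cong_sym)
  finally have "[x * r ^ n1 + s = x] (mod m1)"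
    by (simp add: q_def flip: cong_int_iff)
  \<comment> \<open>The congruence holds modulo \<open>m1\<close>, whereas equality of elements
    needs modulus \<open>m\<close>. The correction \<open>m1 * t\<close> disappears at the end
    through \<open>zm_subgroup_cong\<close>.\<close>
  then obtain t where "[x = x * r ^ n1 + s + m1 * t] (mod m)"
    using cong_dvd_lift[OF m_pos m1] cong_sym by metis
  then have "el 0 x \<otimes> el n1 (s + m1 * t) = el n1 0 \<otimes> el 0 x"
    by (simp add: el_mult el_eq_iff cong_sym_eq add.assoc)
  then have conj1: "inv (el 0 x) \<otimes> el n1 0 \<otimes> el 0 x = el n1 (s + m1 * t)"
    by (simp add: m_assoc inv_solve_left')
  have "el 0 x \<otimes> el 0 m1 = el 0 m1 \<otimes> el 0 x"
    by (simp add: el_mult add.commute)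
  then have conj2: "inv (el 0 x) \<otimes> el 0 m1 \<otimes> el 0 x = el 0 m1"
    by (simp add: m_assoc inv_solve_left')
  let ?c = "\<lambda>g. inv (el 0 x) \<otimes> g \<otimes> el 0 x"
  have "group_hom G G ?c"
    using conjugation_iso[of "el 0 x"] by unfold_locales (auto simp: iso_def)
  then have "?c ` zm_subgroup m1 n1 0 = generate G (?c ` {el 0 m1, el n1 0})"
    unfolding zm_subgroup_def by (subst group_hom.generate_img) auto
  also have "\<dots> = zm_subgroup m1 n1 (s + m1 * t)"
    by (simp add: conj1 conj2 zm_subgroup_def)
  also have "\<dots> = zm_subgroup m1 n1 s"
    by (rule zm_subgroup_cong[OF m1]) (simp add: cong_def)
  finally show ?thesis
    by (intro that[of "el 0 x"]) simp_all
qed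

lemma F2_zm_subgroup:
  assumes "m1 dvd m" "n1 dvd n" "m1 dvd s * norm_sum n1"
  shows "F2 (G\<lparr>carrier := zm_subgroup m1 n1 s\<rparr>) = F2 (G\<lparr>carrier := zm_subgroup m1 n1 0\<rparr>)"
proof -
  obtain x where x: "x \<in> carrier G" "zm_subgroup m1 n1 s = (\<lambda>g. inv x \<otimes> g \<otimes> x) ` zm_subgroup m1 n1 0"
    using zm_subgroup_conjugate[OF assms] .
  show ?thesis
    unfolding x(2) by (rule F2_image_iso[OF group_axioms conjugation_iso[OF x(1)] zm_subgroup_subgroup])
qed

end

section \<open>Normal form of the elements of a ZM-group\<close>

text \<open>
  Right multiplication of \<open>b^j a^i\<close> by a letter, on exponents. This action respects the relations,
  so distinct normal forms are distinct in the presented group.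
\<close>

fun zm_act :: "nat \<Rightarrow> nat \<Rightarrow> nat \<Rightarrow> zm_gen \<times> bool \<Rightarrow> nat \<times> nat \<Rightarrow> nat \<times> nat"
  where
    "zm_act m n r (A, e) (j, i) = (j, (i + (if e then 1 else m - 1)) mod m)"
  | "zm_act m n r (B, e) (j, i) =
      ((j + (if e then 1 else n - 1)) mod n, (i * r ^ (if e then 1 else n - 1)) mod m)"

lemma zm_act_A_power:
  "i < m \<Longrightarrow> (zm_act m n r (A, True) ^^ k) (j, i) = (j, (i + k) mod m)"
  by (induction k) (simp_all add: mod_simps)

lemma zm_act_B_power:
  "j < n \<Longrightarrow> i < m \<Longrightarrow>
    (zm_act m n r (B, True) ^^ k) (j, i) = ((j + k) mod n, (i * r ^ k) mod m)"
  by (induction k) (simp_all add: mod_simps mult_ac)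

lemma zm_act_range:
  assumes "m > 0" "n > 0" "p \<in> {..<n} \<times> {..<m}"
  shows "fold (zm_act m n r) u p \<in> {..<n} \<times> {..<m}"
  using assms(3)
proof (induction u arbitrary: p)
  case (Cons l u)
  have "zm_act m n r l p \<in> {..<n} \<times> {..<m}"
    using Cons.prems assms by (cases "(m, n, r, l, p)" rule: zm_act.cases) auto
  from Cons.IH[OF this] show ?case by simp
qed simp

lemma zm_act_cancel:
  assumes m: "m > 0" and n: "n > 0" and r: "[r ^ n = 1] (mod m)" and p: "p \<in> {..<n} \<times> {..<m}"
  shows "zm_act m n r (x, \<not> e) (zm_act m n r (x, e) p) = p"
proof -
  obtain j i where ji: "p = (j, i)" "j < n" "i < m" using p by auto
  have rn: "i * r ^ n mod m = i"
    using r ji by (metis cong_def mod_less mod_mult_right_eq mult.right_neutral)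
  \<comment> \<open>\<open>r ^ (n - 1)\<close> inverts \<open>r\<close> modulo \<open>m\<close>,
    which is why the inverse letter of \<open>B\<close> multiplies by it.\<close>
  have "r * r ^ (n - Suc 0) = r ^ n" "r ^ (n - Suc 0) * r = r ^ n"
    using n by (cases n; simp)+
  moreover have "(Suc k mod d + d - Suc 0) mod d = k" if "k < d" for k d :: nat
    using that by (cases "Suc k = d") auto
  ultimately show ?thesis
    using ji m n rn by (cases x; cases e) (simp_all add: mod_simps mult.assoc)
qed

text \<open>It suffices that both sides of a rule act alike at every reduced pair: a prefix only
  moves the starting point, which stays reduced by \<open>zm_act_range\<close>.\<close>

lemma zm_act_word_eq:
  assumes m: "m > 0" and n: "n > 0" and r: "[r ^ n = 1] (mod m)"
    and uv: "word_eq (zm_relations m n r) u v" and p: "p \<in> {..<n} \<times> {..<m}"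
  shows "fold (zm_act m n r) u p = fold (zm_act m n r) v p"
  using uv p
proof (induction arbitrary: p)
  case (cancel u x e v)
  then show ?case
    using zm_act_cancel[OF m n r zm_act_range[OF m n cancel]] by simp
next
  case (relation s t u v)
  have "fold (zm_act m n r) s p = fold (zm_act m n r) t p" if p: "p \<in> {..<n} \<times> {..<m}" for p
  proof -
    obtain j i where ji: "p = (j, i)" "j < n" "i < m" using p by auto
    have rn: "i * r ^ n mod m = i"
      using r ji by (metis cong_def mod_less mod_mult_right_eq mult.right_neutral)
    have "r ^ (n - Suc 0) * r = r ^ n"
      using n by (cases n; simp)
    \<comment> \<open>The left side is the effect of \<open>b^-1 a b\<close> on the exponent of
      \<open>a\<close>; modulo \<open>m\<close> it adds \<open>r\<close>, just as \<open>a^r\<close>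
      does.\<close>
    then have "(i * r ^ (n - Suc 0) + 1) * r = i * r ^ n + r"
      by (simp add: algebra_simps)
    then have "(i * r ^ (n - Suc 0) + 1) * r mod m = (i + r) mod m"
      using rn by (metis mod_add_left_eq)
    then show ?thesis
      using relation(1) ji n rn
      by (auto simp: zm_relations_def zm_act_A_power zm_act_B_power mod_simps)
  qed
  from this[OF zm_act_range[OF m n relation(2)]] show ?case by simp
qed auto

definition zm_el :: "nat \<Rightarrow> nat \<Rightarrow> nat \<Rightarrow> nat \<Rightarrow> nat \<Rightarrow> zm_gen word set"
  where "zm_el m n r j i =
    word_class (zm_relations m n r) (replicate j (B, True) @ replicate i (A, True))"

lemma group_ZM: "group (ZM m n r)"
  by (simp add: ZM_def group_presented_group)

lemma ZM_mult: "word_class (zm_relations m n r) u \<otimes>\<^bsub>ZM m n r\<^esub> word_class (zm_relations m n r) v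
    = word_class (zm_relations m n r) (u @ v)"
  by (simp add: ZM_def presented_group_mult)

lemma ZM_one: "\<one>\<^bsub>ZM m n r\<^esub> = word_class (zm_relations m n r) []"
  by (simp add: ZM_def presented_group_one)

lemma ZM_class_closed [simp]: "word_class (zm_relations m n r) u \<in> carrier (ZM m n r)"
  by (simp add: ZM_def presented_group_carrier)

lemma ZM_class_power:
  "word_class (zm_relations m n r) (replicate k l)
    = word_class (zm_relations m n r) [l] [^]\<^bsub>ZM m n r\<^esub> k"
proof (induction k)
  case 0
  show ?case by (simp add: ZM_one monoid.nat_pow_0 group.is_monoid[OF group_ZM])
next
  case (Suc k)
  have "word_class (zm_relations m n r) (replicate (Suc k) l)
    = word_class (zm_relations m n r) (replicate k l) \<otimes>\<^bsub>ZM m n r\<^esub> word_class (zm_relations m n r) [l]"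
    by (simp add: ZM_mult replicate_append_same)
  then show ?case
    by (simp add: Suc monoid.nat_pow_Suc group.is_monoid[OF group_ZM])
qed

lemma zm_el_eq: "zm_el m n r j i
    = zm_b m n r [^]\<^bsub>ZM m n r\<^esub> j \<otimes>\<^bsub>ZM m n r\<^esub> zm_a m n r [^]\<^bsub>ZM m n r\<^esub> i"
  unfolding zm_el_def zm_a_def zm_b_def by (simp add: ZM_mult flip: ZM_class_power)

lemma word_class_relation:
  "(s, t) \<in> R \<Longrightarrow> word_class R s = word_class R t"
  using word_eq.relation[of s t R "[]" "[]"] by (simp add: word_class_eq_iff)

text \<open>The third relation moves \<open>a\<close> to the right past \<open>b\<close>, which
  multiplies normal forms. The first two turn inverse letters into nonnegative powers, so every word
  has a normal form, and \<open>zm_act\<close> separates normal forms.\<close>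

lemma ZM_is_zm_group:
  assumes m: "m > 0" and n: "n > 0" and co: "coprime m n" and r: "[r ^ n = 1] (mod m)"
  shows "zm_group (ZM m n r) m n r (zm_el m n r)"
proof -
  let ?R = "zm_relations m n r"
  interpret group "ZM m n r" by (rule group_ZM)
  define a b where "a = zm_a m n r" and "b = zm_b m n r"
  have closed [simp]: "a \<in> carrier (ZM m n r)" "b \<in> carrier (ZM m n r)"
    by (simp_all add: a_def b_def zm_a_def zm_b_def)
  have el: "zm_el m n r j i = b [^]\<^bsub>ZM m n r\<^esub> j \<otimes>\<^bsub>ZM m n r\<^esub> a [^]\<^bsub>ZM m n r\<^esub> i" for j i
    by (simp add: zm_el_eq a_def b_def)
  have a_order: "a [^]\<^bsub>ZM m n r\<^esub> m = \<one>\<^bsub>ZM m n r\<^esub>"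
    and b_order: "b [^]\<^bsub>ZM m n r\<^esub> n = \<one>\<^bsub>ZM m n r\<^esub>"
    unfolding a_def b_def zm_a_def zm_b_def ZM_one ZM_class_power[symmetric]
    by (rule word_class_relation; simp add: zm_relations_def)+
  have "word_class ?R [(B, False), (A, True), (B, True)] = a [^]\<^bsub>ZM m n r\<^esub> r"
    unfolding a_def zm_a_def ZM_class_power[symmetric]
    by (rule word_class_relation) (simp add: zm_relations_def)
  then have "b \<otimes>\<^bsub>ZM m n r\<^esub> a [^]\<^bsub>ZM m n r\<^esub> r
      = word_class ?R [(B, True), (B, False), (A, True), (B, True)]"
    by (simp add: b_def zm_b_def ZM_mult flip: \<open>_ = a [^]\<^bsub>ZM m n r\<^esub> r\<close>)
  also have "\<dots> = a \<otimes>\<^bsub>ZM m n r\<^esub> b"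
    using word_eq.cancel[of ?R "[]" B True "[(A, True), (B, True)]"]
    by (simp add: a_def zm_a_def b_def zm_b_def ZM_mult word_class_eq_iff)
  finally have ab: "a \<otimes>\<^bsub>ZM m n r\<^esub> b = b \<otimes>\<^bsub>ZM m n r\<^esub> a [^]\<^bsub>ZM m n r\<^esub> r" ..
  have aib: "a [^]\<^bsub>ZM m n r\<^esub> i \<otimes>\<^bsub>ZM m n r\<^esub> b
      = b \<otimes>\<^bsub>ZM m n r\<^esub> a [^]\<^bsub>ZM m n r\<^esub> (i * r)" for i :: nat
  proof (induction i)
    case (Suc i)
    have "a [^]\<^bsub>ZM m n r\<^esub> Suc i \<otimes>\<^bsub>ZM m n r\<^esub> b
        = (a [^]\<^bsub>ZM m n r\<^esub> i \<otimes>\<^bsub>ZM m n r\<^esub> b) \<otimes>\<^bsub>ZM m n r\<^esub> a [^]\<^bsub>ZM m n r\<^esub> r"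
      by (simp add: m_assoc ab)
    also have "\<dots> = b \<otimes>\<^bsub>ZM m n r\<^esub> a [^]\<^bsub>ZM m n r\<^esub> (Suc i * r)"
      unfolding Suc by (simp add: m_assoc nat_pow_mult add.commute)
    finally show ?case .
  qed simp
  have aibk: "a [^]\<^bsub>ZM m n r\<^esub> i \<otimes>\<^bsub>ZM m n r\<^esub> b [^]\<^bsub>ZM m n r\<^esub> k
      = b [^]\<^bsub>ZM m n r\<^esub> k \<otimes>\<^bsub>ZM m n r\<^esub> a [^]\<^bsub>ZM m n r\<^esub> (i * r ^ k)" for i k :: nat
  proof (induction k)
    case (Suc k)
    have "a [^]\<^bsub>ZM m n r\<^esub> i \<otimes>\<^bsub>ZM m n r\<^esub> b [^]\<^bsub>ZM m n r\<^esub> Suc k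
        = (a [^]\<^bsub>ZM m n r\<^esub> i \<otimes>\<^bsub>ZM m n r\<^esub> b [^]\<^bsub>ZM m n r\<^esub> k) \<otimes>\<^bsub>ZM m n r\<^esub> b"
      by (simp add: m_assoc)
    also have "\<dots> = b [^]\<^bsub>ZM m n r\<^esub> k \<otimes>\<^bsub>ZM m n r\<^esub>
        (a [^]\<^bsub>ZM m n r\<^esub> (i * r ^ k) \<otimes>\<^bsub>ZM m n r\<^esub> b)"
      unfolding Suc by (simp add: m_assoc)
    also have "\<dots> = b [^]\<^bsub>ZM m n r\<^esub> Suc k \<otimes>\<^bsub>ZM m n r\<^esub> a [^]\<^bsub>ZM m n r\<^esub> (i * r ^ Suc k)"
      unfolding aib by (simp add: m_assoc mult_ac)
    finally show ?case .
  qed simp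
  have mult: "zm_el m n r j i \<otimes>\<^bsub>ZM m n r\<^esub> zm_el m n r k l = zm_el m n r (j + k) (i * r ^ k + l)"
    for j i k l
  proof -
    have "zm_el m n r j i \<otimes>\<^bsub>ZM m n r\<^esub> zm_el m n r k l
      = b [^]\<^bsub>ZM m n r\<^esub> j \<otimes>\<^bsub>ZM m n r\<^esub>
        (a [^]\<^bsub>ZM m n r\<^esub> i \<otimes>\<^bsub>ZM m n r\<^esub> b [^]\<^bsub>ZM m n r\<^esub> k) \<otimes>\<^bsub>ZM m n r\<^esub> a [^]\<^bsub>ZM m n r\<^esub> l"
      by (simp add: el m_assoc)
    also have "\<dots> = (b [^]\<^bsub>ZM m n r\<^esub> j \<otimes>\<^bsub>ZM m n r\<^esub> b [^]\<^bsub>ZM m n r\<^esub> k) \<otimes>\<^bsub>ZM m n r\<^esub>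
        (a [^]\<^bsub>ZM m n r\<^esub> (i * r ^ k) \<otimes>\<^bsub>ZM m n r\<^esub> a [^]\<^bsub>ZM m n r\<^esub> l)"
      unfolding aibk by (simp add: m_assoc del: nat_pow_mult)
    also have "\<dots> = zm_el m n r (j + k) (i * r ^ k + l)"
      by (simp add: el nat_pow_mult)
    finally show ?thesis .
  qed
  have letter: "\<exists>j i. word_class ?R [l] = zm_el m n r j i" for l
  proof -
    have inverse: "word_class ?R [(x, False)] = word_class ?R [(x, True)] [^]\<^bsub>ZM m n r\<^esub> (k - 1)"
      if "word_class ?R [(x, True)] [^]\<^bsub>ZM m n r\<^esub> k = \<one>\<^bsub>ZM m n r\<^esub>" "k > 0" for x and k :: nat
    proof -
      have "word_class ?R [(x, False)] \<otimes>\<^bsub>ZM m n r\<^esub> word_class ?R [(x, True)] = \<one>\<^bsub>ZM m n r\<^esub>"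
        using word_eq.cancel[of ?R "[]" x False "[]"] by (simp add: ZM_mult ZM_one word_class_eq_iff)
      moreover have "word_class ?R [(x, True)] [^]\<^bsub>ZM m n r\<^esub> (k - 1) \<otimes>\<^bsub>ZM m n r\<^esub>
          word_class ?R [(x, True)] = \<one>\<^bsub>ZM m n r\<^esub>"
        using that by (simp flip: nat_pow_Suc)
      ultimately show ?thesis
        by (metis ZM_class_closed nat_pow_closed inv_equality)
    qed
    obtain x e where l: "l = (x, e)" by (cases l)
    show ?thesis
    proof (cases x)
      case A
      have "word_class ?R [l] = zm_el m n r 0 (if e then 1 else m - 1)"
        using inverse[of A m] a_order m unfolding el by (simp add: A l a_def zm_a_def)
      then show ?thesis by blast
    next
      case B
      have "word_class ?R [l] = zm_el m n r (if e then 1 else n - 1) 0"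
        using inverse[of B n] b_order n unfolding el by (simp add: B l b_def zm_b_def)
      then show ?thesis by blast
    qed
  qed
  have "\<exists>j i. word_class ?R u = zm_el m n r j i" for u
  proof (induction u)
    case Nil
    show ?case by (intro exI[of _ 0]) (simp add: zm_el_def)
  next
    case (Cons l u)
    then show ?case
      using letter[of l] ZM_mult[of m n r "[l]" u] by (metis append_Cons append_Nil mult)
  qed
  then have carrier: "carrier (ZM m n r) = range (case_prod (zm_el m n r))"
    by (force simp: ZM_def presented_group_carrier zm_el_def)
  have eq_iff: "zm_el m n r j i = zm_el m n r k l \<longleftrightarrow> [j = k] (mod n) \<and> [i = l] (mod m)"
    for j i k l
  proof
    assume "zm_el m n r j i = zm_el m n r k l"
    \<comment> \<open>Applied to the pair of zero exponents, a normal form returns its own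
      exponents, reduced modulo \<open>n\<close> and \<open>m\<close>.\<close>
    then have "fold (zm_act m n r) (replicate j (B, True) @ replicate i (A, True)) (0, 0)
      = fold (zm_act m n r) (replicate k (B, True) @ replicate l (A, True)) (0, 0)"
      unfolding zm_el_def word_class_eq_iff by (rule zm_act_word_eq[OF m n r]) (use m n in simp)
    then show "[j = k] (mod n) \<and> [i = l] (mod m)"
      using m n by (simp add: zm_act_A_power zm_act_B_power cong_def)
  next
    have pow_mod: "x [^]\<^bsub>ZM m n r\<^esub> c = x [^]\<^bsub>ZM m n r\<^esub> (c mod d)"
      if "x \<in> carrier (ZM m n r)" "x [^]\<^bsub>ZM m n r\<^esub> d = \<one>\<^bsub>ZM m n r\<^esub>" for x and c d :: nat
    proof -
      have "x [^]\<^bsub>ZM m n r\<^esub> c = x [^]\<^bsub>ZM m n r\<^esub> (d * (c div d) + c mod d)" by simp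
      also have "\<dots> = (x [^]\<^bsub>ZM m n r\<^esub> d) [^]\<^bsub>ZM m n r\<^esub> (c div d)
          \<otimes>\<^bsub>ZM m n r\<^esub> x [^]\<^bsub>ZM m n r\<^esub> (c mod d)"
        using that(1) by (simp only: nat_pow_pow nat_pow_mult)
      also have "\<dots> = x [^]\<^bsub>ZM m n r\<^esub> (c mod d)"
        using that by simp
      finally show ?thesis .
    qed
    assume "[j = k] (mod n) \<and> [i = l] (mod m)"
    then show "zm_el m n r j i = zm_el m n r k l"
      unfolding el by (metis cong_def pow_mod a_order b_order closed)
  qed
  show ?thesis
    by unfold_locales (use m n co r carrier mult eq_iff in simp_all)
qed

section \<open>The subgroup commutativity degree\<close>

text \<open>The solutions are the multiples of \<open>d div gcd d q\<close> below \<open>d\<close>.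
  This counts the values of \<open>s\<close> for given \<open>m1\<close> and
  \<open>n1\<close>.\<close>

lemma card_multiple_solutions:
  fixes d q :: nat
  assumes "d > 0"
  shows "card {s. s < d \<and> d dvd s * q} = gcd d q"
proof -
  define g k where "g = gcd d q" and "k = d div g"
  have g: "g > 0" "d = k * g"
    using assms by (simp_all add: g_def k_def)
  then have k: "k > 0" using assms by auto
  have "d dvd s * q \<longleftrightarrow> k dvd s" for s
  proof -
    obtain q' where q': "q = g * q'" using gcd_dvd2[of d q] unfolding g_def by (rule dvdE)
    have "coprime (d div g) (q div g)"
      unfolding g_def by (rule div_gcd_coprime) (use assms in simp)
    moreover have "q div g = q'" using g(1) by (simp add: q')
    ultimately have "coprime k q'" by (simp add: k_def)
    then show ?thesis
      using g by (simp add: q' mult_ac coprime_dvd_mult_right_iff)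
  qed
  then have "{s. s < d \<and> d dvd s * q} = (\<lambda>t. k * t) ` {..<g}"
    using k by (auto simp: g(2) elim!: dvdE)
  then show ?thesis
    using k by (simp add: card_image inj_on_def flip: g_def)
qed

text \<open>As \<open>k\<close> is positive, the denominator vanishes only for \<open>r = 1\<close>;
  for \<open>r = 0\<close> both differences are \<open>-1\<close> and the sum is
  \<open>1\<close>.\<close>

lemma pow_quot_eq_sum:
  assumes "n > 0" "k dvd n"
  shows "pow_quot r n k = int (\<Sum>i<n div k. (r ^ k) ^ i)"
proof (cases "r = 1")
  case False
  have k: "k > 0" using assms by (auto intro: dvd_pos_nat)
  then have "int r ^ k \<noteq> 1"
    using False by (auto simp: power_eq_1_iff simp flip: of_nat_power)
  moreover have "int r ^ n - 1 = (int r ^ k - 1) * (\<Sum>i<n div k. (int r ^ k) ^ i)"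
    using power_diff_1_eq[of "int r ^ k" "n div k"] assms by (simp flip: power_mult)
  ultimately show ?thesis
    using False by (simp add: pow_quot_def)
qed (simp add: pow_quot_def)

context zm_group
begin

text \<open>The summand ignores \<open>s\<close>, so the inner sum is a multiplicity. With
  \<open>f\<close> constantly \<open>1\<close> this counts subgroups; with \<open>F2\<close> it
  counts commuting pairs.\<close>

lemma sum_params:
  fixes f :: "nat \<Rightarrow> nat \<Rightarrow> real"
  shows "(\<Sum>(m1, n1, s)\<in>params. f m1 n1) = (\<Sum>m1 | m1 dvd m. \<Sum>n1 | n1 dvd n.
    real_of_int (gcd (int m1) (pow_quot r n n1)) * f m1 n1)"
proof -
  have fin: "finite {m1. m1 dvd m}" "finite {n1. n1 dvd n}"
    using m_pos n_pos by simp_all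
  have "(\<Sum>(m1, n1, s)\<in>params. f m1 n1) = (\<Sum>m1 | m1 dvd m. \<Sum>n1 | n1 dvd n.
      \<Sum>s | s < m1 \<and> m1 dvd s * norm_sum n1. f m1 n1)"
    unfolding params_def using fin by (subst sum.Sigma; simp add: sum.Sigma)+
  also have "\<dots> = (\<Sum>m1 | m1 dvd m. \<Sum>n1 | n1 dvd n.
      real_of_int (gcd (int m1) (pow_quot r n n1)) * f m1 n1)"
  proof (rule sum.cong[OF HOL.refl], rule sum.cong[OF HOL.refl])
    fix m1 n1 assume "m1 \<in> {m1. m1 dvd m}" "n1 \<in> {n1. n1 dvd n}"
    then have "m1 > 0" "n1 dvd n"
      using m_pos by (auto intro: dvd_pos_nat)
    then have "gcd (int m1) (pow_quot r n n1) = int (gcd m1 (norm_sum n1))"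
      using n_pos by (simp add: pow_quot_eq_sum norm_sum_def del: of_nat_sum)
    then show "(\<Sum>s | s < m1 \<and> m1 dvd s * norm_sum n1. f m1 n1)
      = real_of_int (gcd (int m1) (pow_quot r n n1)) * f m1 n1"
      using \<open>m1 > 0\<close> by (simp add: card_multiple_solutions)
  qed
  finally show ?thesis .
qed

lemma sd_eq:
  "sd G =
    (\<Sum>m1 | m1 dvd m. \<Sum>n1 | n1 dvd n. real_of_int (gcd (int m1) (pow_quot r n n1)) *
      real (F2 (G\<lparr>carrier := zm_subgroup m1 n1 0\<rparr>)))
    / (\<Sum>m1 | m1 dvd m. \<Sum>n1 | n1 dvd n. real_of_int (gcd (int m1) (pow_quot r n n1)))\<^sup>2"
proof -
  have "real (card (subgroup_lattice G)) = (\<Sum>(m1, n1, s)\<in>params. 1)"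
    using bij_betw_same_card[OF bij_betw_zm_subgroup] by simp
  moreover have "real (card {(H, K) \<in> subgroup_lattice G \<times> subgroup_lattice G. H <#> K = K <#> H})
    = (\<Sum>(m1, n1, s)\<in>params. real (F2 (G\<lparr>carrier := zm_subgroup m1 n1 0\<rparr>)))"
  proof -
    have "(\<Sum>M\<in>subgroup_lattice G. F2 (G\<lparr>carrier := M\<rparr>))
      = (\<Sum>p\<in>params. F2 (G\<lparr>carrier := case p of (m1, n1, s) \<Rightarrow> zm_subgroup m1 n1 s\<rparr>))"
      by (rule sum.reindex_bij_betw[OF bij_betw_zm_subgroup, symmetric])
    also have "\<dots> = (\<Sum>(m1, n1, s)\<in>params. F2 (G\<lparr>carrier := zm_subgroup m1 n1 0\<rparr>))"
    proof (rule sum.cong[OF HOL.refl])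
      fix p assume "p \<in> params"
      moreover obtain m1 n1 s where "p = (m1, n1, s)" by (rule prod_cases3)
      ultimately show "F2 (G\<lparr>carrier := case p of (m1, n1, s) \<Rightarrow> zm_subgroup m1 n1 s\<rparr>)
        = (case p of (m1, n1, s) \<Rightarrow> F2 (G\<lparr>carrier := zm_subgroup m1 n1 0\<rparr>))"
        using F2_zm_subgroup[of m1 n1 s] by (simp add: params_def)
    qed
    finally show ?thesis
      unfolding card_commuting_pairs[OF finite_carrier] by (simp add: case_prod_unfold)
  qed
  ultimately show ?thesis
    unfolding sd_def sum_params by simp
qed

end

lemma zm_H_eq:
  assumes "zm_group (ZM m n r) m n r (zm_el m n r)"
  shows "zm_H m n r m1 n1 = zm_group.zm_subgroup (ZM m n r) (zm_el m n r) m1 n1 0"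
proof -
  interpret zm_group "ZM m n r" m n r "zm_el m n r" by fact
  have "zm_a m n r = zm_el m n r 0 1" "zm_b m n r = zm_el m n r 1 0"
    by (simp_all add: zm_a_def zm_b_def zm_el_def)
  then show ?thesis
    unfolding zm_H_def zm_subgroup_def by (simp add: el_pow)
qed

section \<open>Commuting subgroups when a power of \<open>b\<close> is central or \<open>b\<close>
  inverts \<open>a\<close>\<close>

context zm_group
begin

text \<open>Centrality of \<open>b^n1\<close> makes \<open>norm_sum n1\<close> congruent to
  \<open>n div n1\<close>, hence coprime to \<open>m1\<close>. So \<open>m1\<close> divides
  \<open>s\<close>, and \<open>s\<close> may be replaced by \<open>0\<close>.\<close>

lemma zm_subgroup_normal:
  assumes m1: "m1 dvd m" and n1: "n1 dvd n" and s: "m1 dvd s * norm_sum n1"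
    and central: "[r ^ n1 = 1] (mod m)"
  shows "zm_subgroup m1 n1 s \<lhd> G"
proof -
  have "[norm_sum n1 = (\<Sum>t<n div n1. 1 ^ t)] (mod m)"
    unfolding norm_sum_def by (intro cong_sum cong_pow central)
  then have "[n div n1 = norm_sum n1] (mod m1)"
    using m1 by (auto intro: cong_dvd_modulus_nat cong_sym)
  moreover have "coprime (n div n1) m1"
    using coprime_m_n m1 n1 by (metis coprime_commute coprime_divisors dvd_div_mult_self dvd_triv_left)
  ultimately have "coprime (norm_sum n1) m1"
    using cong_imp_coprime by blast
  then have "m1 dvd s"
    using s by (simp add: coprime_commute coprime_dvd_mult_left_iff)
  then have eq: "zm_subgroup m1 n1 s = zm_subgroup m1 n1 0"
    by (intro zm_subgroup_cong m1) (simp add: cong_0_iff)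
  show ?thesis
    unfolding eq normal_inv_iff
  proof (intro conjI zm_subgroup_subgroup ballI)
    fix g h assume g: "g \<in> carrier G" and h: "h \<in> zm_subgroup m1 n1 0"
    obtain j i where ji: "g = el j i" using g by (rule el_cases)
    obtain l y where ly: "h = el l y" using h el_cases subgroup.mem_carrier[OF zm_subgroup_subgroup] by metis
    have "n1 dvd l" using mem_zm_subgroup_dvd[OF m1 n1, of 0 l y] h by (simp add: ly)
    then obtain k where l: "l = n1 * k" ..
    have y: "m1 dvd y"
      using mem_zm_subgroup_iff[OF m1 n1, of 0 k y] h by (simp add: ly l cong_0_iff)
    \<comment> \<open>\<open>?u\<close> is the inverse of \<open>r ^ j\<close> modulo
      \<open>m\<close>: the conjugate of \<open>h\<close> by \<open>g\<close> has exponent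
      \<open>y * ?u\<close> of \<open>a\<close>.\<close>
    let ?u = "r ^ ((n - 1) * j)"
    have h': "el l (y * ?u) \<in> zm_subgroup m1 n1 0"
      using mem_zm_subgroup_iff[OF m1 n1, of 0 k "y * ?u"] y by (simp add: l cong_0_iff)
    have "?u * r ^ j = (r ^ n) ^ j"
      using n_pos by (cases n) (simp_all add: algebra_simps flip: power_add power_mult)
    then have "[y * (?u * r ^ j) + i = y * 1 ^ j + i * 1 ^ k] (mod m)"
      using cong_pow[OF r_pow_n, of j] by (intro cong_add cong_mult cong_refl) simp_all
    moreover have "[i * (r ^ n1) ^ k + y = i * 1 ^ k + y * 1 ^ j] (mod m)"
      by (intro cong_add cong_mult cong_pow central cong_refl) simp
    ultimately have "[y * ?u * r ^ j + i = i * r ^ l + y] (mod m)"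
      by (simp add: cong_def mult.assoc add.commute l power_mult)
    then have "g \<otimes> h = el l (y * ?u) \<otimes> g"
      by (simp add: ji ly el_mult el_eq_iff cong_sym_eq add.commute)
    then have "g \<otimes> h \<otimes> inv g = el l (y * ?u)"
      using g by (simp add: m_assoc)
    then show "g \<otimes> h \<otimes> inv g \<in> zm_subgroup m1 n1 0" using h' by simp
  qed
qed

lemma geometric_sum_cong_parity:
  assumes "[int r = - 1] (mod d)"
  shows "[int (\<Sum>t<k. r ^ t) = (if even k then 0 else 1)] (mod d)"
proof -
  have "[int (\<Sum>t<k. r ^ t) = (\<Sum>t<k. (- 1) ^ t)] (mod d)"
    using assms by (simp add: cong_sum cong_pow)
  also have "(\<Sum>t<k. (- 1) ^ t) = (if even k then 0 else 1 :: int)"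
    by (induction k) auto
  finally show ?thesis .
qed

text \<open>When \<open>b\<close> inverts \<open>a\<close>, the exponent of \<open>a\<close> in an
  element of either subgroup depends modulo \<open>m1\<close> only on the parity of its exponent of
  \<open>b\<close>. Commuting is tested on a single product; conversely, congruent parameters make
  one subgroup contain the other.\<close>

lemma zm_subgroup_commute_iff_inverting:
  assumes r: "m dvd r + 1" and n: "even n" and m2: "m2 dvd m" and m12: "m1 dvd m2"
  shows "zm_subgroup m1 1 s <#> zm_subgroup m2 1 t = zm_subgroup m2 1 t <#> zm_subgroup m1 1 s \<longleftrightarrow> [s = t] (mod m1)"
proof -
  have m1: "m1 dvd m" using m12 m2 by (rule dvd_trans)
  have r_neg: "[int r = - 1] (mod int d)" if "d dvd m" for d
  proof -
    have "int d dvd int (r + 1)"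
      using dvd_trans[OF that r] by (simp only: int_dvd_int_iff)
    then show ?thesis by (simp add: cong_iff_dvd_diff add.commute)
  qed
  \<comment> \<open>For even \<open>n\<close> the alternating sum \<open>norm_sum 1\<close> vanishes
    modulo \<open>d\<close>, so every parameter is admissible.\<close>
  have valid: "d dvd x * norm_sum 1" if "d dvd m" for d x
  proof -
    have "[int (norm_sum 1) = 0] (mod int d)"
      using geometric_sum_cong_parity[OF r_neg[OF that], of n] n by (simp add: norm_sum_def)
    then show ?thesis by (simp add: cong_0_iff)
  qed
  have mem: "[int x = int u * (if even k then 0 else 1)] (mod int m1)"
    if "el k x \<in> zm_subgroup d 1 u" "d dvd m" "m1 dvd d" for k x u d
  proof -
    have "[x = u * (\<Sum>t<k. r ^ t)] (mod d)"
      using mem_zm_subgroup_iff[OF that(2) one_dvd valid[OF that(2)], of k x u] that(1) by simp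
    then have "[x = u * (\<Sum>t<k. r ^ t)] (mod m1)"
      using that(3) by (rule cong_dvd_modulus_nat)
    then have "[int x = int u * int (\<Sum>t<k. r ^ t)] (mod int m1)"
      by (simp only: cong_int_iff flip: of_nat_mult)
    also have "[int u * int (\<Sum>t<k. r ^ t) = int u * (if even k then 0 else 1)] (mod int m1)"
      using m1 by (intro cong_mult cong_refl geometric_sum_cong_parity r_neg)
    finally show ?thesis .
  qed
  show ?thesis
  proof
    assume comm: "zm_subgroup m1 1 s <#> zm_subgroup m2 1 t = zm_subgroup m2 1 t <#> zm_subgroup m1 1 s"
    \<comment> \<open>The product of the two generators in the other order has exponent 2 of
      \<open>b\<close>, so in any rewriting \<open>h \<otimes> k\<close> the exponents of
      \<open>b\<close> have equal parity.\<close>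
    have "el 1 t \<otimes> el 1 s \<in> zm_subgroup m2 1 t <#> zm_subgroup m1 1 s"
      unfolding set_mult_def by (intro UN_I[OF zm_subgroup_generators(2)]) simp
    then have "el 1 t \<otimes> el 1 s \<in> zm_subgroup m1 1 s <#> zm_subgroup m2 1 t"
      by (simp only: comm)
    then obtain h k where hk: "h \<in> zm_subgroup m1 1 s" "k \<in> zm_subgroup m2 1 t" "el 1 t \<otimes> el 1 s = h \<otimes> k"
      unfolding set_mult_def by (elim UN_E) simp
    then obtain a x b y where h: "h = el a x" and k: "k = el b y"
      using el_cases subgroup.mem_carrier[OF zm_subgroup_subgroup] by metis
    have "[2 = a + b] (mod n)" and mod_m: "[t * r + s = x * r ^ b + y] (mod m)"
      using hk(3) by (simp_all add: h k el_mult el_eq_iff numeral_2_eq_2)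
    then have "[2 = a + b] (mod 2)"
      using n cong_dvd_modulus_nat by blast
    then have parity: "even a \<longleftrightarrow> even b"
      by (simp add: cong_def) presburger
    let ?e = "if even b then 0 else 1 :: int"
    have "[int t * (- 1) + int s = int t * int r + int s] (mod int m1)"
      using m1 by (intro cong_add cong_mult cong_refl cong_sym[OF r_neg])
    also have "[int t * int r + int s = int x * int r ^ b + int y] (mod int m1)"
      using cong_dvd_modulus_nat[OF mod_m m1]
      by (simp only: cong_int_iff flip: of_nat_mult of_nat_power of_nat_add)
    also have "[int x * int r ^ b + int y = int s * ?e * (- 1) ^ b + int t * ?e] (mod int m1)"
      using mem[of a x m1 s] mem[of b y m2 t] hk m1 m2 m12 parity
      by (intro cong_add cong_mult cong_pow r_neg) (simp_all add: h k)
    \<comment> \<open>Even exponents give \<open>s - t = 0\<close> modulo \<open>m1\<close>; odd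
      ones give \<open>s - t = t - s\<close>, where the factor 2 cancels because \<open>m1\<close>
      is coprime to the even \<open>n\<close>.\<close>
    finally have "int m1 dvd int s - int t \<or> int m1 dvd 2 * (int s - int t)"
      by (auto simp: cong_iff_dvd_diff algebra_simps split: if_splits)
    moreover have "coprime (int m1) 2"
      using coprime_m_n m1 n by (metis coprime_divisors int_ops(3) coprime_int_iff)
    ultimately have "int m1 dvd int s - int t"
      using coprime_dvd_mult_right_iff[of "int m1" 2 "int s - int t"] by blast
    then show "[s = t] (mod m1)"
      by (simp add: cong_iff_dvd_diff flip: cong_int_iff)
  next
    assume st: "[s = t] (mod m1)"
    have "zm_subgroup m2 1 t \<subseteq> zm_subgroup m1 1 s"
    proof (rule zm_subgroup_subset[OF zm_subgroup_subgroup])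
      show "el 0 m2 \<in> zm_subgroup m1 1 s"
        using m12 mem_zm_subgroup_0_iff[OF m1 one_dvd valid[OF m1]] by simp
      show "el 1 t \<in> zm_subgroup m1 1 s"
        using st mem_zm_subgroup_iff[OF m1 one_dvd valid[OF m1], of 1 t s] by (simp add: cong_sym_eq)
    qed
    then have "zm_subgroup m1 1 s <#> zm_subgroup m2 1 t = zm_subgroup m1 1 s"
      by (intro set_mult_subgroup_idem zm_subgroup_subgroup subgroup_incl)
    then show "zm_subgroup m1 1 s <#> zm_subgroup m2 1 t = zm_subgroup m2 1 t <#> zm_subgroup m1 1 s"
      using set_mult_commute_iff_subgroup[OF zm_subgroup_subgroup zm_subgroup_subgroup] zm_subgroup_subgroup by metis
  qed
qed

end

section \<open>The example \<open>ZM 9 4 8\<close>\<close>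

definition params_9_4_8 :: "(nat \<times> nat \<times> nat) list"
  where "params_9_4_8 = [(m1, n1, s). m1 \<leftarrow> [1, 3, 9], n1 \<leftarrow> [1, 2, 4], s \<leftarrow> [0..<m1], n1 = 1 \<or> s = 0]"

definition commuting_9_4_8 :: "(nat \<times> nat \<times> nat) \<times> (nat \<times> nat \<times> nat) \<Rightarrow> bool"
  where "commuting_9_4_8 = (\<lambda>((m1, n1, s), (m2, n2, t)).
    n1 \<noteq> 1 \<or> n2 \<noteq> 1 \<or> s mod gcd m1 m2 = t mod gcd m1 m2)"

lemma distinct_params_9_4_8: "distinct params_9_4_8"
  and length_params_9_4_8: "length params_9_4_8 = 19"
  by code_simp+

text \<open>Of the 361 pairs, 192 have some second parameter different from 1 and all of these
  commute; among the other 169, the congruence holds for 55.\<close>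

lemma length_commuting_9_4_8:
  "length (filter commuting_9_4_8 (List.product params_9_4_8 params_9_4_8)) = 247"
  by code_simp

lemma sd_ZM_9_4_8: "sd (ZM 9 4 8) = 13 / 19"
proof -
  interpret zm_group "ZM 9 4 8" 9 4 8 "zm_el 9 4 8"
  proof (rule ZM_is_zm_group)
    show "coprime 9 (4 :: nat)" by code_simp
  qed (simp_all add: cong_def)
  let ?G = "ZM 9 4 8" and ?L = "subgroup_lattice (ZM 9 4 8)"
  define f where "f = (\<lambda>(m1, n1, s). zm_subgroup m1 n1 s)"
  have dvd9: "{d. d dvd (9::nat)} = {1, 3, 9}"
  proof -
    have "{d. d dvd (9::nat)} = {d \<in> {..9}. d dvd 9}" by (auto dest: dvd_imp_le)
    also have "\<dots> = {1, 3, 9}" by code_simp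
    finally show ?thesis .
  qed
  have dvd4: "{d. d dvd (4::nat)} = {1, 2, 4}"
  proof -
    have "{d. d dvd (4::nat)} = {d \<in> {..4}. d dvd 4}" by (auto dest: dvd_imp_le)
    also have "\<dots> = {1, 2, 4}" by code_simp
    finally show ?thesis .
  qed
  have set_comprehension: "set [(x, y, z). x \<leftarrow> xs, y \<leftarrow> ys, z \<leftarrow> [0..<x], P x y z]
    = (SIGMA x:set xs. SIGMA y:set ys. {z. z < x \<and> P x y z})"
    for xs ys :: "nat list" and P :: "nat \<Rightarrow> nat \<Rightarrow> nat \<Rightarrow> bool"
    by auto
  have norm_sum: "norm_sum 1 = 585" "norm_sum 2 = 65" "norm_sum 4 = 1"
    by (simp_all add: norm_sum_def lessThan_nat_numeral lessThan_Suc)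
  \<comment> \<open>9 divides 585, so \<open>n1 = 1\<close> allows every \<open>s\<close>; 65 and 1
    are coprime to 3, which forces \<open>s = 0\<close> otherwise.\<close>
  have "s < m1 \<and> m1 dvd s * norm_sum n1 \<longleftrightarrow> s < m1 \<and> (n1 = 1 \<or> s = 0)"
    if "m1 \<in> {1, 3, 9}" "n1 \<in> {1, 2, 4}" for m1 n1 s
    using that by (elim insertE emptyE; simp add: norm_sum[simplified]; presburger?)
  then have "params = (SIGMA m1:{1, 3, 9}. SIGMA n1:{1, 2, 4}. {s. s < m1 \<and> (n1 = 1 \<or> s = 0)})"
    unfolding params_def dvd9 dvd4 by (intro Sigma_cong HOL.refl) simp
  then have ps: "params = set params_9_4_8"
    unfolding params_9_4_8_def set_comprehension by simp
  have f: "bij_betw f (set params_9_4_8) ?L"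
    using bij_betw_zm_subgroup by (simp add: f_def ps)
  have "card ?L = 19"
    using bij_betw_same_card[OF f] distinct_card[OF distinct_params_9_4_8] length_params_9_4_8 by simp
  have C: "f p <#>\<^bsub>?G\<^esub> f p' = f p' <#>\<^bsub>?G\<^esub> f p \<longleftrightarrow> commuting_9_4_8 (p, p')"
    if "p \<in> params" "p' \<in> params" for p p'
  proof -
    obtain m1 n1 s m2 n2 t where p: "p = (m1, n1, s)" "p' = (m2, n2, t)"
      by (metis prod_cases3)
    have normal: "zm_subgroup d k u \<lhd> ?G" if "(d, k, u) \<in> params" "k \<noteq> 1" for d k u
    proof (rule zm_subgroup_normal)
      have "k \<in> {1, 2, 4}"
        using that(1) unfolding dvd4[symmetric] by (simp add: params_def)
      then show "[8 ^ k = 1 :: nat] (mod 9)"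
        using that(2) by (auto simp: cong_def)
    qed (use that(1) in \<open>auto simp: params_def\<close>)
    show ?thesis
    proof (cases "n1 = 1 \<and> n2 = 1")
      case True
      have dvd: "m1 dvd 9" "m2 dvd 9"
        using that by (simp_all add: p params_def)
      then have "m1 \<in> {1, 3, 9}" "m2 \<in> {1, 3, 9}"
        unfolding dvd9[symmetric] by simp_all
      \<comment> \<open>The divisors of 9 form a chain, so the gcd is the smaller of
        \<open>m1\<close> and \<open>m2\<close>; the inverting criterion applies because 9 divides 8
        + 1 and 4 is even.\<close>
      then have "m1 dvd m2 \<or> m2 dvd m1"
        by auto
      then show ?thesis
        using zm_subgroup_commute_iff_inverting[of m2 m1 s t] zm_subgroup_commute_iff_inverting[of m1 m2 t s] dvd True
        by (auto simp: p f_def commuting_9_4_8_def cong_def gcd_nat.absorb1 gcd_nat.absorb2)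
    next
      case False
      have "zm_subgroup m1 n1 s <#>\<^bsub>?G\<^esub> zm_subgroup m2 n2 t = zm_subgroup m2 n2 t <#>\<^bsub>?G\<^esub> zm_subgroup m1 n1 s"
      proof (cases "n1 = 1")
        case True
        then show ?thesis
          using False that by (intro commut_normal zm_subgroup_subgroup normal) (simp_all add: p)
      next
        case False
        then show ?thesis
          using that by (intro commut_normal[symmetric] zm_subgroup_subgroup normal) (simp_all add: p)
      qed
      then show ?thesis
        using False by (auto simp: p f_def commuting_9_4_8_def)
    qed
  qed
  have bij: "bij_betw (map_prod f f) (params \<times> params) (?L \<times> ?L)"
    using f f unfolding ps[symmetric] by (rule bij_betw_map_prod)
  define S where "S = {(H, K) \<in> ?L \<times> ?L. H <#>\<^bsub>?G\<^esub> K = K <#>\<^bsub>?G\<^esub> H}"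
  \<comment> \<open>Pulling the commuting pairs back along the bijection turns the count into the
    evaluation of a filtered list.\<close>
  have "S = {q \<in> map_prod f f ` (params \<times> params). fst q <#>\<^bsub>?G\<^esub> snd q = snd q <#>\<^bsub>?G\<^esub> fst q}"
    unfolding S_def bij_betw_imp_surj_on[OF bij] by auto
  also have "\<dots> = map_prod f f ` {p \<in> params \<times> params. commuting_9_4_8 p}"
    unfolding Compr_image_eq by (intro arg_cong[where f = "image _"] Collect_cong conj_cong HOL.refl)
      (elim SigmaE, simp add: C)
  finally have "card S = card (map_prod f f ` {p \<in> params \<times> params. commuting_9_4_8 p})"
    by (rule arg_cong)
  also have "\<dots> = card {p \<in> params \<times> params. commuting_9_4_8 p}"
    by (rule card_image, rule inj_on_subset[OF bij_betw_imp_inj_on[OF bij]]) blast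
  also have "\<dots> = card (set (filter commuting_9_4_8 (List.product params_9_4_8 params_9_4_8)))"
    unfolding ps set_filter set_product ..
  also have "\<dots> = length (filter commuting_9_4_8 (List.product params_9_4_8 params_9_4_8))"
    by (intro distinct_card distinct_filter distinct_product distinct_params_9_4_8)
  also note length_commuting_9_4_8
  finally show ?thesis
    unfolding S_def using \<open>card ?L = 19\<close> by (simp add: sd_def)
qed

theorem theorem4p2:
  shows "(\<forall>m n r :: nat.
            m \<ge> 1 \<longrightarrow> n \<ge> 1 \<longrightarrow>
            gcd m n = 1 \<longrightarrow> gcd (int m) (int r - 1) = 1 \<longrightarrow>
            [r ^ n = 1] (mod m) \<longrightarrow>
            sd (ZM m n r) =
              (\<Sum>m1 | m1 dvd m. \<Sum>n1 | n1 dvd n.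
                 real_of_int (gcd (int m1) (pow_quot r n n1)) * real (zm_f m n r m1 n1))
              / (\<Sum>m1 | m1 dvd m. \<Sum>n1 | n1 dvd n.
                 real_of_int (gcd (int m1) (pow_quot r n n1)))\<^sup>2)
         \<and> sd (ZM 9 4 8) = 13 / 19"
proof (intro conjI allI impI)
  fix m n r :: nat
  assume "m \<ge> 1" "n \<ge> 1" "gcd m n = 1" "[r ^ n = 1] (mod m)"
  then have zm: "zm_group (ZM m n r) m n r (zm_el m n r)"
    by (intro ZM_is_zm_group) (auto simp: coprime_iff_gcd_eq_1)
  show "sd (ZM m n r) =
              (\<Sum>m1 | m1 dvd m. \<Sum>n1 | n1 dvd n.
                 real_of_int (gcd (int m1) (pow_quot r n n1)) * real (zm_f m n r m1 n1))
              / (\<Sum>m1 | m1 dvd m. \<Sum>n1 | n1 dvd n.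
                 real_of_int (gcd (int m1) (pow_quot r n n1)))\<^sup>2"
    unfolding zm_f_def zm_H_eq[OF zm] by (rule zm_group.sd_eq[OF zm])
qed (rule sd_ZM_9_4_8)

end
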